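(* Let $S$ be a semigroup, $z_0\in S$ a fixed element and $\sigma:S\to S$ an involutive automorphism. The solutions $f,g:S\to\mathbb{C}$ of the Kannappan-sine subtraction law $$f(x\sigma(y)z_0)=f(x)g(y)-f(y)g(x),\qquad x,y\in S,$$ can be listed as follows. (1) $f=0$ and $g$ is arbitrary. (2) $S\neq S^2z_0$, $f$ is any non-zero function such that $f(S^2z_0)=0$, and $g=\kappa f$, where $\kappa\in\mathbb{C}$ is a constant. (3) There exist constants $\gamma,b\in\mathbb{C}^{*}$, $c\in\mathbb{C}\setminus\{\pm1\}$ and an exponential function $\chi$ on $S$ with $\chi\neq\chi\circ\sigma$, $\chi(z_0)=\dfrac{-2b}{1+c}$ and $\chi\circ\sigma(z_0)=\dfrac{2b}{1-c}$ such that $$f=\frac{\chi+\chi\circ\sigma}{2\gamma}+c\,\frac{\chi-\chi\circ\sigma}{2\gamma}\quad\text{and}\quad g=b(\chi-\chi\circ\sigma).$$ (4) There exist constants $\beta,b\in\mathbb{C}^{*}$, $c\in\mathbb{C}$ and an exponential function $\chi$ on $S$ with $\chi\neq\chi\circ\sigma$ and $\chi(z_0)=\chi\circ\sigma(z_0)=1/\beta$ such that $$f=b(\chi-\chi\circ\sigma)\quad\text{and}\quad g=\frac{\chi+\chi\circ\sigma}{2\beta}+c\,\frac{\chi-\chi\circ\sigma}{2\beta}.$$ (5) There exist constants $\alpha,\delta,b\in\mathbb{C}^{*}$, $c\in\mathbb{C}$ and an exponential function $\chi$ on $S$ with $\alpha\neq\pm(2b\delta+\alpha c)$, $\chi\neq\chi\circ\sigma$,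 $\chi(z_0)=\dfrac{2b}{\alpha(1+c)+2b\delta}$ and $\chi\circ\sigma(z_0)=\dfrac{2b}{\alpha(c-1)+2b\delta}$ such that $$f=\alpha\,\frac{\chi+\chi\circ\sigma}{2\delta}+(\alpha c+2b\delta)\,\frac{\chi-\chi\circ\sigma}{2\delta}\quad\text{and}\quad g=\frac{\chi+\chi\circ\sigma}{2\delta}+c\,\frac{\chi-\chi\circ\sigma}{2\delta}.$$ (6) There exist constants $\gamma,c\in\mathbb{C}^{*}$, an exponential function $\chi$ on $S$, a non-zero additive function $A:S\setminus I_\chi\to\mathbb{C}$ and a function $\rho:P_\chi\to\mathbb{C}$ with $\chi\circ\sigma=\chi$, $A\circ\sigma=-A$, $\rho\circ\sigma=-\rho$ and $\chi(z_0)=A(z_0)=\dfrac{-1}{c}$ such that $$f=\gamma\left(\chi+c\,\Psi_{A\chi,\rho}\right)\quad\text{and}\quad g=\Psi_{A\chi,\rho}.$$ (7) There exist constants $\alpha,c\in\mathbb{C}$ and $\delta\in\mathbb{C}^{*}$, an exponential function $\chi$ on $S$, a non-zero additive function $A:S\setminus I_\chi\to\mathbb{C}$ and a function $\rho:P_\chi\to\mathbb{C}$ with $\alpha c+\delta\neq0$, $\chi\circ\sigma=\chi$, $A\circ\sigma=-A$, $\rho\circ\sigma=-\rho$, $\chi(z_0)=\dfrac{1}{\alpha c+\delta}$ and $A(z_0)=-\dfrac{\alpha}{\alpha c+\delta}$ such that $$f=\frac1\delta\left[\alpha\chi+(\alpha c+\delta)\Psi_{A\chi,\rho}\right]\quad\text{and}\quad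 g=\frac1\delta\left(\chi+c\,\Psi_{A\chi,\rho}\right).$$ Moreover, if $S$ is a topological semigroup and $f,g\in C(S)$, then $\chi,\chi\circ\sigma\in C(S)$, $A\in C(S\setminus I_\chi)$ and $\rho\in C(P_\chi)$.
   Context: A semigroup is a set with an associative composition rule. An involutive automorphism $\sigma:S\to S$ is a bijection with $\sigma(xy)=\sigma(x)\sigma(y)$ and $\sigma(\sigma(x))=x$ for all $x,y\in S$. $\mathbb{C}^{*}=\mathbb{C}\setminus\{0\}$. $S^2z_0:=\{xyz_0: x,y\in S\}$, and $f(S^2z_0)=0$ means that $f$ vanishes on this set. For a topological space $X$, $C(X)$ denotes the continuous functions $X\to\mathbb{C}$; subsets of $S$ carry the subspace topology. A function $\chi:S\to\mathbb{C}$ is multiplicative if $\chi(xy)=\chi(x)\chi(y)$ for all $x,y\in S$; it is an exponential if moreover $\chi\neq0$. For a subset $T\subseteq S$, $T^2:=\{xy: x,y\in T\}$. For an exponential $\chi$, the null space is $I_\chi:=\{x\in S:\chi(x)=0\}$; $S\setminus I_\chi$ is a subsemigroup of $S$. A function $A$ from a semigroup $T$ to $\mathbb{C}$ is additive if $A(xy)=A(x)+A(y)$ for all $x,y\in T$. Define $$P_\chi:=\{p\in I_\chi\setminus I_\chi^2:\ up,\,pv,\,upv\in I_\chi\setminus I_\chi^2\ \text{for all } u,v\in S\setminus I_\chi\}.$$ If $\chi\circ\sigma=\chi$, then $\sigma$ maps each of $S\setminus I_\chi$, $P_\chi$ and $I_\chi\setminus P_\chi$ into itself. For an exponential $\chi:S\to\mathbb{C}$,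 an additive $A:S\setminus I_\chi\to\mathbb{C}$ and $\rho:P_\chi\to\mathbb{C}$, $\Psi_{A\chi,\rho}:S\to\mathbb{C}$ denotes the function $$\Psi_{A\chi,\rho}(x)=\begin{cases}A(x)\chi(x)& x\in S\setminus I_\chi,\\ \rho(x)& x\in P_\chi,\\ 0& x\in I_\chi\setminus P_\chi,\end{cases}$$ where it is part of the notation (i.e. required whenever $\Psi_{A\chi,\rho}$ is written) that the following two conditions hold: (i) $\Psi_{A\chi,\rho}(xy)=\Psi_{A\chi,\rho}(yx)=0$ for all $x\in I_\chi\setminus P_\chi$ and $y\in S\setminus I_\chi$; (ii) for all $p\in P_\chi$ and $u,v\in S\setminus I_\chi$ (so that $up,pv,upv\in P_\chi$), $\rho(up)=\rho(p)\chi(u)$, $\rho(pv)=\rho(p)\chi(v)$ and $\rho(upv)=\rho(p)\chi(uv)$.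
   Formalization: In (7), "A non-zero" is replaced by "A and ρ not both zero", since the printed list is incomplete: it misses e.g. S={1,p,q,0} with non-units multiplying to 0, σ swapping p and q, z₀=1, f=δ_p−δ_q, g=δ_1. *)

theory Defs
  imports "HOL-Analysis.Analysis"
begin

text \<open>Exponentials (usually written chi) are called \<open>\<mu>\<close>, since chi is a binder in HOL-Analysis.\<close>

definition involutive_automorphism :: "('a::semigroup_mult \<Rightarrow> 'a) \<Rightarrow> bool" where
  "involutive_automorphism \<sigma> \<longleftrightarrow>
     bij \<sigma> \<and> (\<forall>x y. \<sigma> (x * y) = \<sigma> x * \<sigma> y) \<and> (\<forall>x. \<sigma> (\<sigma> x) = x)"

definition multiplicative :: "('a::semigroup_mult \<Rightarrow> complex) \<Rightarrow> bool" where
  "multiplicative \<mu> \<longleftrightarrow> (\<forall>x y. \<mu> (x * y) = \<mu> x * \<mu> y)"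

definition exponential :: "('a::semigroup_mult \<Rightarrow> complex) \<Rightarrow> bool" where
  "exponential \<mu> \<longleftrightarrow> multiplicative \<mu> \<and> \<mu> \<noteq> (\<lambda>x. 0)"

definition set_square :: "'a::semigroup_mult set \<Rightarrow> 'a set" where
  "set_square T = {x * y | x y. x \<in> T \<and> y \<in> T}"

definition null_space :: "('a::semigroup_mult \<Rightarrow> complex) \<Rightarrow> 'a set" where
  "null_space \<mu> = {x. \<mu> x = 0}"

definition P_set :: "('a::semigroup_mult \<Rightarrow> complex) \<Rightarrow> 'a set" where
  "P_set \<mu> = (let I = null_space \<mu>; J = I - set_square I in
     {p \<in> J. \<forall>u \<in> - I. \<forall>v \<in> - I. u * p \<in> J \<and> p * v \<in> J \<and> u * p * v \<in> J})"

text \<open>Functions on a subset of the semigroup (such as \<open>A\<close> on \<open>S \ I\<^sub>\<mu>\<close> and \<open>\<rho>\<close> on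
  \<open>P\<^sub>\<mu>\<close>) are total functions of which only the values on that subset are ever used.\<close>

definition additive_on :: "'a::semigroup_mult set \<Rightarrow> ('a \<Rightarrow> complex) \<Rightarrow> bool" where
  "additive_on T A \<longleftrightarrow> (\<forall>x \<in> T. \<forall>y \<in> T. A (x * y) = A x + A y)"

definition nonzero_on :: "'a set \<Rightarrow> ('a \<Rightarrow> complex) \<Rightarrow> bool" where
  "nonzero_on T h \<longleftrightarrow> (\<exists>x \<in> T. h x \<noteq> 0)"

definition odd_on :: "'a set \<Rightarrow> ('a \<Rightarrow> 'a) \<Rightarrow> ('a \<Rightarrow> complex) \<Rightarrow> bool" where
  "odd_on T \<sigma> h \<longleftrightarrow> (\<forall>x \<in> T. h (\<sigma> x) = - h x)"

definition Psi :: "('a::semigroup_mult \<Rightarrow> complex) \<Rightarrow> ('a \<Rightarrow> complex) \<Rightarrow> ('a \<Rightarrow> complex) \<Rightarrow> 'a \<Rightarrow> complex"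
  where
  "Psi \<mu> A \<rho> x =
     (if x \<in> - null_space \<mu> then A x * \<mu> x else if x \<in> P_set \<mu> then \<rho> x else 0)"

text \<open>The two conditions that are part of the notation \<open>\<Psi>\<close>.\<close>

definition Psi_conditions ::
  "('a::semigroup_mult \<Rightarrow> complex) \<Rightarrow> ('a \<Rightarrow> complex) \<Rightarrow> ('a \<Rightarrow> complex) \<Rightarrow> bool" where
  "Psi_conditions \<mu> A \<rho> \<longleftrightarrow>
     (\<forall>x \<in> null_space \<mu> - P_set \<mu>. \<forall>y \<in> - null_space \<mu>.
        Psi \<mu> A \<rho> (x * y) = 0 \<and> Psi \<mu> A \<rho> (y * x) = 0) \<and>
     (\<forall>p \<in> P_set \<mu>. \<forall>u \<in> - null_space \<mu>. \<forall>v \<in> - null_space \<mu>.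
        \<rho> (u * p) = \<rho> p * \<mu> u \<and> \<rho> (p * v) = \<rho> p * \<mu> v \<and> \<rho> (u * p * v) = \<rho> p * \<mu> (u * v))"

definition kannappan_sine_subtraction ::
  "('a::semigroup_mult \<Rightarrow> 'a) \<Rightarrow> 'a \<Rightarrow> ('a \<Rightarrow> complex) \<Rightarrow> ('a \<Rightarrow> complex) \<Rightarrow> bool" where
  "kannappan_sine_subtraction \<sigma> z\<^sub>0 f g \<longleftrightarrow>
     (\<forall>x y. f (x * \<sigma> y * z\<^sub>0) = f x * g y - f y * g x)"

definition S2z :: "'a::semigroup_mult \<Rightarrow> 'a set" where
  "S2z z\<^sub>0 = {x * y * z\<^sub>0 | x y. True}"

text \<open>The solution families carry their parameters explicitly, because the continuity claims concern
  every choice of parameters that represents \<open>f\<close> and \<open>g\<close>.\<close>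

definition family3 ::
  "('a::semigroup_mult \<Rightarrow> 'a) \<Rightarrow> 'a \<Rightarrow> ('a \<Rightarrow> complex) \<Rightarrow> ('a \<Rightarrow> complex) \<Rightarrow>
   complex \<Rightarrow> complex \<Rightarrow> complex \<Rightarrow> ('a \<Rightarrow> complex) \<Rightarrow> bool" where
  "family3 \<sigma> z\<^sub>0 f g \<gamma> b c \<mu> \<longleftrightarrow>
     \<gamma> \<noteq> 0 \<and> b \<noteq> 0 \<and> c \<noteq> 1 \<and> c \<noteq> -1 \<and> exponential \<mu> \<and> \<mu> \<noteq> \<mu> \<circ> \<sigma> \<and>
     \<mu> z\<^sub>0 = - 2 * b / (1 + c) \<and> (\<mu> \<circ> \<sigma>) z\<^sub>0 = 2 * b / (1 - c) \<and>
     f = (\<lambda>x. (\<mu> x + (\<mu> \<circ> \<sigma>) x) / (2 * \<gamma>) + c * ((\<mu> x - (\<mu> \<circ> \<sigma>) x) / (2 * \<gamma>))) \<and>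
     g = (\<lambda>x. b * (\<mu> x - (\<mu> \<circ> \<sigma>) x))"

definition family4 ::
  "('a::semigroup_mult \<Rightarrow> 'a) \<Rightarrow> 'a \<Rightarrow> ('a \<Rightarrow> complex) \<Rightarrow> ('a \<Rightarrow> complex) \<Rightarrow>
   complex \<Rightarrow> complex \<Rightarrow> complex \<Rightarrow> ('a \<Rightarrow> complex) \<Rightarrow> bool" where
  "family4 \<sigma> z\<^sub>0 f g \<beta> b c \<mu> \<longleftrightarrow>
     \<beta> \<noteq> 0 \<and> b \<noteq> 0 \<and> exponential \<mu> \<and> \<mu> \<noteq> \<mu> \<circ> \<sigma> \<and>
     \<mu> z\<^sub>0 = 1 / \<beta> \<and> (\<mu> \<circ> \<sigma>) z\<^sub>0 = 1 / \<beta> \<and>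
     f = (\<lambda>x. b * (\<mu> x - (\<mu> \<circ> \<sigma>) x)) \<and>
     g = (\<lambda>x. (\<mu> x + (\<mu> \<circ> \<sigma>) x) / (2 * \<beta>) + c * ((\<mu> x - (\<mu> \<circ> \<sigma>) x) / (2 * \<beta>)))"

definition family5 ::
  "('a::semigroup_mult \<Rightarrow> 'a) \<Rightarrow> 'a \<Rightarrow> ('a \<Rightarrow> complex) \<Rightarrow> ('a \<Rightarrow> complex) \<Rightarrow>
   complex \<Rightarrow> complex \<Rightarrow> complex \<Rightarrow> complex \<Rightarrow> ('a \<Rightarrow> complex) \<Rightarrow> bool" where
  "family5 \<sigma> z\<^sub>0 f g \<alpha> \<delta> b c \<mu> \<longleftrightarrow>
     \<alpha> \<noteq> 0 \<and> \<delta> \<noteq> 0 \<and> b \<noteq> 0 \<and>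
     \<alpha> \<noteq> 2 * b * \<delta> + \<alpha> * c \<and> \<alpha> \<noteq> - (2 * b * \<delta> + \<alpha> * c) \<and>
     exponential \<mu> \<and> \<mu> \<noteq> \<mu> \<circ> \<sigma> \<and>
     \<mu> z\<^sub>0 = 2 * b / (\<alpha> * (1 + c) + 2 * b * \<delta>) \<and>
     (\<mu> \<circ> \<sigma>) z\<^sub>0 = 2 * b / (\<alpha> * (c - 1) + 2 * b * \<delta>) \<and>
     f = (\<lambda>x. \<alpha> * ((\<mu> x + (\<mu> \<circ> \<sigma>) x) / (2 * \<delta>))
              + (\<alpha> * c + 2 * b * \<delta>) * ((\<mu> x - (\<mu> \<circ> \<sigma>) x) / (2 * \<delta>))) \<and>
     g = (\<lambda>x. (\<mu> x + (\<mu> \<circ> \<sigma>) x) / (2 * \<delta>) + c * ((\<mu> x - (\<mu> \<circ> \<sigma>) x) / (2 * \<delta>)))"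

definition family6 ::
  "('a::semigroup_mult \<Rightarrow> 'a) \<Rightarrow> 'a \<Rightarrow> ('a \<Rightarrow> complex) \<Rightarrow> ('a \<Rightarrow> complex) \<Rightarrow>
   complex \<Rightarrow> complex \<Rightarrow> ('a \<Rightarrow> complex) \<Rightarrow> ('a \<Rightarrow> complex) \<Rightarrow> ('a \<Rightarrow> complex) \<Rightarrow> bool" where
  "family6 \<sigma> z\<^sub>0 f g \<gamma> c \<mu> A \<rho> \<longleftrightarrow>
     \<gamma> \<noteq> 0 \<and> c \<noteq> 0 \<and> exponential \<mu> \<and>
     additive_on (- null_space \<mu>) A \<and> nonzero_on (- null_space \<mu>) A \<and>
     \<mu> \<circ> \<sigma> = \<mu> \<and> odd_on (- null_space \<mu>) \<sigma> A \<and> odd_on (P_set \<mu>) \<sigma> \<rho> \<and>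
     \<mu> z\<^sub>0 = - 1 / c \<and> A z\<^sub>0 = - 1 / c \<and> Psi_conditions \<mu> A \<rho> \<and>
     f = (\<lambda>x. \<gamma> * (\<mu> x + c * Psi \<mu> A \<rho> x)) \<and>
     g = Psi \<mu> A \<rho>"

text \<open>In this family it is \<open>(A, \<rho>)\<close>, i.e. \<open>\<Psi>\<close>, that is required to be non-zero. For
  \<open>\<alpha> \<noteq> 0\<close> this amounts to \<open>A \<noteq> 0\<close>, because \<open>A z\<^sub>0 \<noteq> 0\<close>. For \<open>\<alpha> = 0\<close> there are also
  solutions with \<open>A = 0\<close> and \<open>\<rho> \<noteq> 0\<close> which occur in no other family: take the monoid
  \<open>{1, p, q, 0}\<close> in which any two non-units have product \<open>0\<close>, let \<open>\<sigma>\<close> swap \<open>p\<close> and \<open>q\<close>,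
  and put \<open>z\<^sub>0 = 1\<close>, \<open>f p = 1\<close>, \<open>f q = -1\<close>, \<open>f 1 = f 0 = 0\<close>, \<open>g 1 = 1\<close>,
  \<open>g p = g q = g 0 = 0\<close>.\<close>

definition family7 ::
  "('a::semigroup_mult \<Rightarrow> 'a) \<Rightarrow> 'a \<Rightarrow> ('a \<Rightarrow> complex) \<Rightarrow> ('a \<Rightarrow> complex) \<Rightarrow>
   complex \<Rightarrow> complex \<Rightarrow> complex \<Rightarrow> ('a \<Rightarrow> complex) \<Rightarrow> ('a \<Rightarrow> complex) \<Rightarrow> ('a \<Rightarrow> complex) \<Rightarrow> bool" where
  "family7 \<sigma> z\<^sub>0 f g \<alpha> c \<delta> \<mu> A \<rho> \<longleftrightarrow>
     \<delta> \<noteq> 0 \<and> exponential \<mu> \<and>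
     additive_on (- null_space \<mu>) A \<and>
     (nonzero_on (- null_space \<mu>) A \<or> nonzero_on (P_set \<mu>) \<rho>) \<and>
     \<alpha> * c + \<delta> \<noteq> 0 \<and>
     \<mu> \<circ> \<sigma> = \<mu> \<and> odd_on (- null_space \<mu>) \<sigma> A \<and> odd_on (P_set \<mu>) \<sigma> \<rho> \<and>
     \<mu> z\<^sub>0 = 1 / (\<alpha> * c + \<delta>) \<and> A z\<^sub>0 = - \<alpha> / (\<alpha> * c + \<delta>) \<and> Psi_conditions \<mu> A \<rho> \<and>
     f = (\<lambda>x. 1 / \<delta> * (\<alpha> * \<mu> x + (\<alpha> * c + \<delta>) * Psi \<mu> A \<rho> x)) \<and>
     g = (\<lambda>x. 1 / \<delta> * (\<mu> x + c * Psi \<mu> A \<rho> x))"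

text \<open>The topology is an explicit value instead of a type class constraint, so that the algebraic
  part of the theorem is about arbitrary semigroups.\<close>

definition topological_semigroup :: "'a::semigroup_mult topology \<Rightarrow> bool" where
  "topological_semigroup X \<longleftrightarrow>
     topspace X = UNIV \<and> continuous_map (prod_topology X X) X (\<lambda>(x, y). x * y)"

abbreviation continuous_fun :: "'a topology \<Rightarrow> ('a \<Rightarrow> complex) \<Rightarrow> bool" where
  "continuous_fun X h \<equiv> continuous_map X euclidean h"

end

theory Submission
  imports Defs
begin

text \<open>If \<open>f\<close> and \<open>g\<close> are linearly independent, their span is invariant under right
  translations, so \<open>k x = f (x * z\<^sub>0)\<close> lies in it, and the equation says that \<open>k (x * \<sigma> y)\<close> is
  the determinant of \<open>(f, g)\<close> at \<open>x, y\<close>. Completing \<open>k\<close> to a suitable basis \<open>k, h\<close> turns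
  this into the sine subtraction law. Associativity then forces \<open>k\<close> to be odd and, after adding a
  multiple of \<open>k\<close>, \<open>h\<close> to be even, with the addition law
  \<open>h (x * y) = h x * h y + s * k x * k y\<close>. With \<open>t\<^sup>2 = s\<close> the functions \<open>h \<plusminus> t * k\<close> are
  multiplicative and swapped by \<open>\<sigma>\<close>. For \<open>s \<noteq> 0\<close> they span the families 3 to 5; for
  \<open>s = 0\<close>, \<open>k\<close> is a \<open>\<Psi>\<close> over the exponential \<open>h\<close> (families 6 and 7). The constants are
  read off by comparing coefficients.\<close>

section \<open>Linear independence of two functions and two-by-two determinants\<close>

definition lin_indep :: "('a \<Rightarrow> complex) \<Rightarrow> ('a \<Rightarrow> complex) \<Rightarrow> bool" where
  "lin_indep f g \<longleftrightarrow> (\<forall>a b. (\<forall>x. a * f x + b * g x = 0) \<longrightarrow> a = 0 \<and> b = 0)"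

lemma lin_indep_zeroD:
  assumes "lin_indep f g" and "\<And>x. a * f x + b * g x = 0"
  shows "a = 0" "b = 0"
  using assms unfolding lin_indep_def by blast+

lemma lin_indep_coeff_eq:
  assumes "lin_indep f g" and "\<And>x. a * f x + b * g x = c * f x + d * g x"
  shows "a = c" "b = d"
proof -
  have "(a - c) * f x + (b - d) * g x = 0" for x
    using assms(2)[of x] by (simp add: algebra_simps)
  from lin_indep_zeroD[OF assms(1) this] show "a = c" "b = d" by simp_all
qed

lemma lin_indep_nonzero:
  assumes "lin_indep f g"
  shows "\<exists>x. f x \<noteq> 0" "\<exists>x. g x \<noteq> 0"
proof -
  show "\<exists>x. f x \<noteq> 0"
    using lin_indep_zeroD[OF assms, of 1 0] by force
  show "\<exists>x. g x \<noteq> 0"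
    using lin_indep_zeroD[OF assms, of 0 1] by force
qed

text \<open>If the determinant were zero, the combinations \<open>c * f - a * g\<close> and
  \<open>d * f - b * g\<close>, which eliminate \<open>p\<close> and \<open>q\<close> respectively,
  would both vanish. This forces \<open>a = b = 0\<close> and thus \<open>f = 0\<close>.\<close>

lemma lin_indep_det_coeffs:
  assumes "lin_indep f g"
    and f: "\<And>x. f x = a * p x + b * q x" and g: "\<And>x. g x = c * p x + d * q x"
  shows "a * d - b * c \<noteq> 0"
proof
  assume det: "a * d - b * c = 0"
  have "c * f x + (- a) * g x = - (a * d - b * c) * q x" for x
    by (simp add: f g algebra_simps)
  then have 1: "c * f x + (- a) * g x = 0" for x using det by simp
  have "d * f x + (- b) * g x = (a * d - b * c) * p x" for x
    by (simp add: f g algebra_simps)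
  then have 2: "d * f x + (- b) * g x = 0" for x using det by simp
  have "a = 0" "b = 0"
    using lin_indep_zeroD[OF assms(1) 1] lin_indep_zeroD[OF assms(1) 2] by simp_all
  then show False using lin_indep_nonzero(1)[OF assms(1)] f by simp
qed

lemma lin_indep_transform:
  assumes "lin_indep p q" and det: "a * d - b * c \<noteq> 0"
  shows "lin_indep (\<lambda>x. a * p x + b * q x) (\<lambda>x. c * p x + d * q x)"
  unfolding lin_indep_def
proof (intro allI impI)
  fix r s assume *: "\<forall>x. r * (a * p x + b * q x) + s * (c * p x + d * q x) = 0"
  have "(r * a + s * c) * p x + (r * b + s * d) * q x = 0" for x
    using spec[OF *, of x] by (simp add: algebra_simps)
  from lin_indep_zeroD[OF assms(1) this]
  have 1: "r * a + s * c = 0" and 2: "r * b + s * d = 0" .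
  \<comment> \<open>Cramer's rule for the system given by 1 and 2.\<close>
  have "r * (a * d - b * c) = d * (r * a + s * c) - c * (r * b + s * d)"
    by (simp add: algebra_simps)
  moreover have "s * (a * d - b * c) = a * (r * b + s * d) - b * (r * a + s * c)"
    by (simp add: algebra_simps)
  ultimately show "r = 0 \<and> s = 0" using 1 2 det by simp
qed

text \<open>If all these determinants vanished, \<open>- g y * f + f y * g = 0\<close> would be a
  nontrivial relation for any \<open>y\<close> with \<open>f y \<noteq> 0\<close>. The two points
  serve later to solve the functional equation for \<open>f\<close>.\<close>

lemma lin_indep_exists_det:
  assumes "lin_indep f g"
  shows "\<exists>y z. f y * g z - f z * g y \<noteq> 0"
proof (rule ccontr)
  assume "\<not> ?thesis"
  then have *: "f y * g z - f z * g y = 0" for y z by blast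
  obtain y where "f y \<noteq> 0" using lin_indep_nonzero(1)[OF assms] by blast
  moreover have "- g y * f z + f y * g z = 0" for z
    using *[of y z] by (simp add: algebra_simps)
  ultimately show False using lin_indep_zeroD(2)[OF assms] by blast
qed

lemma lin_dep_multiple:
  assumes "\<not> lin_indep f g" "f \<noteq> (\<lambda>x. 0)"
  shows "\<exists>\<kappa>. g = (\<lambda>x. \<kappa> * f x)"
proof -
  obtain a b where ab: "\<And>x. a * f x + b * g x = 0" "a \<noteq> 0 \<or> b \<noteq> 0"
    using assms(1) unfolding lin_indep_def by blast
  obtain x where "f x \<noteq> 0" using assms(2) by blast
  then have "b \<noteq> 0" using ab(1)[of x] ab(2) by auto
  have "g x = (- a / b) * f x" for x
  proof -
    have "b * g x = - (a * f x)" using ab(1)[of x] by (simp add: eq_neg_iff_add_eq_0 add.commute)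
    then show ?thesis using \<open>b \<noteq> 0\<close> by (simp add: field_simps)
  qed
  then show ?thesis by blast
qed

section \<open>Reduction to the sine subtraction law\<close>

lemma involutive_automorphismD:
  assumes "involutive_automorphism \<sigma>"
  shows "\<sigma> (x * y) = \<sigma> x * \<sigma> y" "\<sigma> (\<sigma> x) = x"
  using assms unfolding involutive_automorphism_def by auto

text \<open>\<open>span {f, g}\<close> is invariant under right translations, because \<open>f\<close> and \<open>g\<close> are
  combinations of the functions \<open>x \<mapsto> f (x * \<sigma> y * z)\<close>.\<close>

lemma kannappan_translate:
  assumes \<sigma>: "involutive_automorphism \<sigma>" and eq: "kannappan_sine_subtraction \<sigma> z f g"
    and fg: "lin_indep f g"
  shows "\<exists>p q. \<forall>x. f (x * a) = p * f x + q * g x"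
proof -
  note E = eq[unfolded kannappan_sine_subtraction_def, rule_format]
  note [simp] = involutive_automorphismD[OF \<sigma>]
  obtain y1 y2 where D: "f y1 * g y2 - f y2 * g y1 \<noteq> 0" (is "?D \<noteq> 0")
    using lin_indep_exists_det[OF fg] by blast
  let ?F = "\<lambda>y x. f x * g y - f y * g x"
  \<comment> \<open>Since \<open>x * a * \<sigma> y = x * \<sigma> (\<sigma> a * y)\<close>,
    translating \<open>x\<close> by \<open>a\<close> amounts to a change of \<open>y\<close>, which
    only affects the coefficients of \<open>f x\<close> and \<open>g x\<close>.\<close>
  have F: "?F y (x * a) = f x * g (\<sigma> a * y) - f (\<sigma> a * y) * g x" for x y
    using E[of "x * a" y] E[of x "\<sigma> a * y"] by (simp add: mult.assoc)
  \<comment> \<open>The terms in \<open>g x\<close> cancel, so \<open>f\<close> is a combination of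
    \<open>?F y1\<close> and \<open>?F y2\<close>.\<close>
  have inv: "?D * f x = f y1 * ?F y2 x - f y2 * ?F y1 x" for x
    by (simp add: algebra_simps)
  let ?p = "f y1 * g (\<sigma> a * y2) - f y2 * g (\<sigma> a * y1)"
  let ?q = "f y2 * f (\<sigma> a * y1) - f y1 * f (\<sigma> a * y2)"
  have "?D * f (x * a) = ?p * f x + ?q * g x" for x
    unfolding inv[of "x * a"] F by (simp add: algebra_simps)
  then have "f (x * a) = ?p / ?D * f x + ?q / ?D * g x" for x
    using D by (simp add: divide_simps mult.commute)
  then show ?thesis by blast
qed

text \<open>The identities result from evaluating \<open>k (x * \<sigma> y * z)\<close> in two ways.\<close>

lemma sine_subtraction_companion:
  assumes \<sigma>: "involutive_automorphism \<sigma>" and kl: "lin_indep k l"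
    and law: "\<And>x y. k (x * \<sigma> y) = k x * l y - k y * l x"
  obtains a \<eta> \<nu> where "\<And>x y. l (x * \<sigma> y) = a y * k x + (\<eta> * k y + \<nu> * l y) * l x"
    and "\<And>y z. k (\<sigma> z) * a y = l y * l (\<sigma> z) - l (y * \<sigma> z)"
    and "\<And>z. k (\<sigma> z) * \<eta> = l z - l (\<sigma> z)"
    and "\<And>z. k (\<sigma> z) * \<nu> = - k z"
proof -
  note [simp] = involutive_automorphismD[OF \<sigma>]
  have assoc: "k (\<sigma> z) * l (x * \<sigma> y) = (l y * l (\<sigma> z) - l (y * \<sigma> z)) * k x
      + (k y * (l z - l (\<sigma> z)) - k z * l y) * l x" for x y z
  proof -
    have "k (x * \<sigma> (y * \<sigma> z)) = k ((x * \<sigma> y) * \<sigma> (\<sigma> z))"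
      by (simp add: mult.assoc)
    then show ?thesis
      unfolding law by (simp add: algebra_simps)
  qed
  obtain z0 where "k z0 \<noteq> 0" using lin_indep_nonzero(1)[OF kl] by blast
  \<comment> \<open>\<open>w\<close> makes \<open>k (\<sigma> w) = k z0\<close> nonzero, so
    \<open>assoc\<close> at \<open>z = w\<close> can be solved for
    \<open>l (x * \<sigma> y)\<close>. For arbitrary \<open>z\<close>, comparing coefficients first
    in \<open>x\<close> and then in \<open>y\<close> shows that the same \<open>a\<close>,
    \<open>\<eta>\<close> and \<open>\<nu>\<close> fit.\<close>
  define w where "w = \<sigma> z0"
  have w: "k (\<sigma> w) \<noteq> 0" using \<open>k z0 \<noteq> 0\<close> by (simp add: w_def)
  define a where "a y = (l y * l (\<sigma> w) - l (y * \<sigma> w)) / k (\<sigma> w)" for y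
  define \<eta> where "\<eta> = (l w - l (\<sigma> w)) / k (\<sigma> w)"
  define \<nu> where "\<nu> = - k w / k (\<sigma> w)"
  have l: "l (x * \<sigma> y) = a y * k x + (\<eta> * k y + \<nu> * l y) * l x" for x y
  proof -
    have "k (\<sigma> w) * a y = l y * l (\<sigma> w) - l (y * \<sigma> w)"
      "k (\<sigma> w) * \<eta> = l w - l (\<sigma> w)" "k (\<sigma> w) * \<nu> = - k w"
      using w by (simp_all add: a_def \<eta>_def \<nu>_def)
    then have "k (\<sigma> w) * (a y * k x + (\<eta> * k y + \<nu> * l y) * l x) = k (\<sigma> w) * l (x * \<sigma> y)"
      unfolding assoc[of w x y] by algebra
    then show ?thesis using w by simp
  qed
  have cmp: "k (\<sigma> z) * a y = l y * l (\<sigma> z) - l (y * \<sigma> z)"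
    "k (\<sigma> z) * (\<eta> * k y + \<nu> * l y) = k y * (l z - l (\<sigma> z)) - k z * l y" for y z
  proof -
    have "(k (\<sigma> z) * a y) * k x + (k (\<sigma> z) * (\<eta> * k y + \<nu> * l y)) * l x =
      (l y * l (\<sigma> z) - l (y * \<sigma> z)) * k x + (k y * (l z - l (\<sigma> z)) - k z * l y) * l x" for x
      using assoc[of z x y] unfolding l[of x y] by algebra
    from lin_indep_coeff_eq[OF kl this] show
      "k (\<sigma> z) * a y = l y * l (\<sigma> z) - l (y * \<sigma> z)"
      "k (\<sigma> z) * (\<eta> * k y + \<nu> * l y) = k y * (l z - l (\<sigma> z)) - k z * l y" .
  qed
  have par: "k (\<sigma> z) * \<eta> = l z - l (\<sigma> z)" "k (\<sigma> z) * \<nu> = - k z" for z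
  proof -
    have "(k (\<sigma> z) * \<eta>) * k y + (k (\<sigma> z) * \<nu>) * l y = (l z - l (\<sigma> z)) * k y + (- k z) * l y" for y
      using cmp(2)[of z y] by algebra
    from lin_indep_coeff_eq[OF kl this]
    show "k (\<sigma> z) * \<eta> = l z - l (\<sigma> z)" "k (\<sigma> z) * \<nu> = - k z" .
  qed
  show thesis using that[OF l cmp(1) par] .
qed

text \<open>Using \<open>k (\<sigma> z) * \<nu> = - k z\<close> twice gives
  \<open>\<nu> * \<nu> = 1\<close>, so \<open>k\<close> is odd or even. If \<open>k\<close> were
  even, so would be \<open>l\<close>, and the formulas for \<open>l (x * \<sigma> y)\<close> would
  make \<open>l\<close> a multiple of \<open>k\<close>.\<close>

lemma sine_subtraction_odd:
  assumes \<sigma>: "involutive_automorphism \<sigma>" and kl: "lin_indep k l"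
    and law: "\<And>x y. k (x * \<sigma> y) = k x * l y - k y * l x"
  shows "k (\<sigma> x) = - k x"
proof -
  note [simp] = involutive_automorphismD[OF \<sigma>]
  obtain a \<eta> \<nu> where l: "\<And>x y. l (x * \<sigma> y) = a y * k x + (\<eta> * k y + \<nu> * l y) * l x"
    and a: "\<And>y z. k (\<sigma> z) * a y = l y * l (\<sigma> z) - l (y * \<sigma> z)"
    and \<eta>: "\<And>z. k (\<sigma> z) * \<eta> = l z - l (\<sigma> z)"
    and \<nu>: "\<And>z. k (\<sigma> z) * \<nu> = - k z"
    by (rule sine_subtraction_companion[where k = k and l = l, OF \<sigma> kl law]) (rule that)
  obtain z where z: "k z \<noteq> 0" using lin_indep_nonzero(1)[OF kl] by blast
  have "k z * (\<nu> * \<nu>) = k z"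
    using \<nu>[of z] \<nu>[of "\<sigma> z"] by (simp add: algebra_simps)
  then have "\<nu> * \<nu> = 1" using z by simp
  moreover have "\<nu> \<noteq> -1"
  proof
    assume "\<nu> = -1"
    then have even: "k (\<sigma> x) = k x" for x using \<nu>[of x] by simp
    have "k z * \<eta> = - (k z * \<eta>)"
      using \<eta>[of z] \<eta>[of "\<sigma> z"] even[of z] by (metis minus_diff_eq involutive_automorphismD(2)[OF \<sigma>])
    then have "\<eta> = 0" using z by simp
    then have l_even: "l (\<sigma> x) = l x" for x using \<eta>[of x] by simp
    \<comment> \<open>Eliminating \<open>l (x * \<sigma> y)\<close> between \<open>a\<close> and
      \<open>l\<close> leaves a relation symmetric in \<open>x\<close> and \<open>y\<close>.\<close>
    have tensor: "2 * l x * l y = k x * a y + k y * a x" for x y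
      using a[of y x] l[of x y] even[of y] l_even[of y] \<open>\<nu> = -1\<close> \<open>\<eta> = 0\<close>
      by (simp add: algebra_simps)
    \<comment> \<open>Read off from \<open>tensor\<close> at \<open>z\<close>; these constants place
      \<open>a\<close> in the span of \<open>k\<close> and \<open>l\<close>.\<close>
    define r t where "r = 2 * l z / k z" and "t = a z / k z"
    have a': "a y = r * l y - t * k y" for y
      using tensor[of z y] z by (simp add: r_def t_def field_simps)
    have "(r * l y - 2 * t * k y) * k x + (r * k y) * l x = 0 * k x + (2 * l y) * l x" for x y
      using tensor[of x y] unfolding a' by algebra
    from lin_indep_coeff_eq(2)[OF kl this] have "r * k y + (- 2) * l y = 0" for y by simp
    from lin_indep_zeroD(2)[OF kl this] show False by simp
  qed
  ultimately have "\<nu> = 1" by (metis square_eq_1_iff)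
  then show ?thesis using \<nu>[of x] by simp
qed

text \<open>Adding a multiple of \<open>k\<close> to \<open>l\<close> leaves the right-hand side of
  \<open>law\<close> unchanged, so \<open>l\<close> may be replaced by its even part
  \<open>h\<close>. For the pair \<open>k\<close>, \<open>h\<close> the companion coefficients
  become 0 and 1, and \<open>a\<close> becomes a multiple of \<open>k\<close>.\<close>

lemma sine_subtraction_law:
  assumes \<sigma>: "involutive_automorphism \<sigma>" and kl: "lin_indep k l"
    and law: "\<And>x y. k (x * \<sigma> y) = k x * l y - k y * l x"
  obtains m h s where "\<And>x. l x = h x + m * k x"
    and "\<And>x. k (\<sigma> x) = - k x" "\<And>x. h (\<sigma> x) = h x"
    and "\<And>x y. k (x * y) = k x * h y + k y * h x"
    and "\<And>x y. h (x * y) = h x * h y + s * k x * k y"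
proof -
  note [simp] = involutive_automorphismD[OF \<sigma>]
  have odd: "k (\<sigma> x) = - k x" for x by (rule sine_subtraction_odd[where k = k and l = l, OF \<sigma> kl law])
  obtain a \<eta> \<nu> where "\<And>x y. l (x * \<sigma> y) = a y * k x + (\<eta> * k y + \<nu> * l y) * l x"
    and "\<And>y z. k (\<sigma> z) * a y = l y * l (\<sigma> z) - l (y * \<sigma> z)"
    and \<eta>: "\<And>z. k (\<sigma> z) * \<eta> = l z - l (\<sigma> z)"
    and "\<And>z. k (\<sigma> z) * \<nu> = - k z"
    by (rule sine_subtraction_companion[where k = k and l = l, OF \<sigma> kl law]) (rule that)
  \<comment> \<open>As \<open>l x - l (\<sigma> x) = - \<eta> * k x\<close>, this is the average of
    \<open>l x\<close> and \<open>l (\<sigma> x)\<close>.\<close>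
  define h where "h x = l x + \<eta> / 2 * k x" for x
  have h_\<sigma>: "h (\<sigma> x) = h x" for x
    using \<eta>[of x] by (simp add: h_def odd algebra_simps)
  have k_sub: "k (x * \<sigma> y) = k x * h y - k y * h x" for x y
    unfolding law h_def by (simp add: algebra_simps)
  have k_add: "k (x * y) = k x * h y + k y * h x" for x y
    using k_sub[of x "\<sigma> y"] h_\<sigma> odd by simp
  have "lin_indep (\<lambda>x. 1 * k x + 0 * l x) (\<lambda>x. \<eta> / 2 * k x + 1 * l x)"
    by (rule lin_indep_transform[OF kl]) simp
  then have kh: "lin_indep k h" by (simp add: h_def[abs_def] add.commute)
  obtain a \<eta>' \<nu> where h: "\<And>x y. h (x * \<sigma> y) = a y * k x + (\<eta>' * k y + \<nu> * h y) * h x"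
    and a: "\<And>y z. k (\<sigma> z) * a y = h y * h (\<sigma> z) - h (y * \<sigma> z)"
    and \<eta>': "\<And>z. k (\<sigma> z) * \<eta>' = h z - h (\<sigma> z)"
    and \<nu>: "\<And>z. k (\<sigma> z) * \<nu> = - k z"
    by (rule sine_subtraction_companion[where k = k and l = h, OF \<sigma> kh k_sub]) (rule that)
  obtain z where z: "k z \<noteq> 0" using lin_indep_nonzero(1)[OF kl] by blast
  have "\<eta>' = 0" "\<nu> = 1"
    using \<eta>'[of z] \<nu>[of z] z by (simp_all add: h_\<sigma> odd)
  then have h': "h (x * \<sigma> y) = a y * k x + h y * h x" for x y
    using h by simp
  define s where "s = a z / k z"
  have "a y = s * k y" for y
    using a[of z y] h'[of y z] z by (simp add: s_def h_\<sigma> odd field_simps)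
  \<comment> \<open>Passing from \<open>x * \<sigma> y\<close> to \<open>x * y\<close> replaces
    \<open>k y\<close> by \<open>k (\<sigma> y) = - k y\<close>, hence the sign.\<close>
  then have "h (x * y) = h x * h y + (- s) * k x * k y" for x y
    using h'[of x "\<sigma> y"] by (simp add: odd h_\<sigma>)
  moreover have "l x = h x + (- \<eta> / 2) * k x" for x by (simp add: h_def)
  ultimately show thesis using that odd h_\<sigma> k_add by blast
qed

lemma kannappan_sine_reduction:
  assumes \<sigma>: "involutive_automorphism \<sigma>" and eq: "kannappan_sine_subtraction \<sigma> z f g"
    and fg: "lin_indep f g"
  obtains k h s f1 f2 g1 g2 where "lin_indep h k"
    and "\<And>x. f x = f1 * h x + f2 * k x" "\<And>x. g x = g1 * h x + g2 * k x"
    and "\<And>x. k (\<sigma> x) = - k x" "\<And>x. h (\<sigma> x) = h x"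
    and "\<And>x y. k (x * y) = k x * h y + k y * h x"
    and "\<And>x y. h (x * y) = h x * h y + s * k x * k y"
proof -
  note E = eq[unfolded kannappan_sine_subtraction_def, rule_format]
  obtain u w where k: "\<And>x. f (x * z) = u * f x + w * g x"
    using kannappan_translate[OF \<sigma> eq fg] by blast
  define k where "k x = f (x * z)" for x
  have k_span: "k x = u * f x + w * g x" for x by (simp add: k_def k)
  have k_law: "k (x * \<sigma> y) = f x * g y - f y * g x" for x y
    by (simp add: k_def E)
  have uw: "u \<noteq> 0 \<or> w \<noteq> 0"
  proof (rule ccontr)
    assume "\<not> ?thesis"
    then have "f x * g y - f y * g x = 0" for x y
      using k_law[of x y] k_span by simp
    then show False using lin_indep_exists_det[OF fg] by blast
  qed
  \<comment> \<open>Completes \<open>(u, w)\<close> to a matrix of determinant 1, so that the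
    determinant of \<open>f\<close>, \<open>g\<close> at \<open>x\<close>, \<open>y\<close> equals
    that of \<open>k\<close>, \<open>l\<close>.\<close>
  obtain v t where vt: "u * t - w * v = 1"
  proof (cases "u = 0")
    case True
    then show thesis using uw that[of 0 "- 1 / w"] by simp
  next
    case False
    then show thesis using that[of "1 / u" 0] by simp
  qed
  define l where "l x = v * f x + t * g x" for x
  have kl: "lin_indep k l"
    unfolding k_span[abs_def] l_def[abs_def]
    by (rule lin_indep_transform[OF fg]) (use vt in simp)
  have law: "k (x * \<sigma> y) = k x * l y - k y * l x" for x y
  proof -
    have "k x * l y - k y * l x = (u * t - w * v) * (f x * g y - f y * g x)"
      unfolding k_span l_def by (simp add: algebra_simps)
    then show ?thesis using vt k_law by simp
  qed
  obtain m h s where h: "\<And>x. l x = h x + m * k x"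
    and props: "\<And>x. k (\<sigma> x) = - k x" "\<And>x. h (\<sigma> x) = h x"
      "\<And>x y. k (x * y) = k x * h y + k y * h x"
      "\<And>x y. h (x * y) = h x * h y + s * k x * k y"
    by (rule sine_subtraction_law[where k = k and l = l, OF \<sigma> kl law]) (rule that)
  have h': "h x = - m * k x + 1 * l x" for x using h[of x] by simp
  have "lin_indep (\<lambda>x. - m * k x + 1 * l x) (\<lambda>x. 1 * k x + 0 * l x)"
    by (rule lin_indep_transform[OF kl]) simp
  then have hk: "lin_indep h k" by (simp add: h'[abs_def])
  \<comment> \<open>Inserting the determinant 1 lets the change of basis be inverted.\<close>
  have "f x = (u * t - w * v) * f x" "g x = (u * t - w * v) * g x" for x
    using vt by simp_all
  then have fg': "f x = t * k x - w * l x" "g x = u * l x - v * k x" for x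
    unfolding k_span l_def by (simp_all add: algebra_simps)
  have "f x = - w * h x + (t - w * m) * k x" "g x = u * h x + (u * m - v) * k x" for x
    unfolding fg' h by (simp_all add: algebra_simps)
  then show thesis using that hk props by blast
qed

section \<open>Two distinct exponentials: families 3 to 5\<close>

lemma exponentialD:
  assumes "exponential \<mu>"
  shows "\<mu> (x * y) = \<mu> x * \<mu> y" "\<exists>x. \<mu> x \<noteq> 0"
  using assms unfolding exponential_def multiplicative_def by auto

text \<open>The determinant of \<open>f\<close>, \<open>g\<close> at \<open>x\<close>,
  \<open>y\<close> is \<open>a * d - b * c\<close> times
  \<open>\<mu> x * \<mu> (\<sigma> y) - \<mu> (\<sigma> x) * \<mu> y\<close>, and the conditions
  \<open>z\<close> give \<open>f (x * \<sigma> y * z)\<close> the same coefficients. Families 3 to 5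
  are all verified through this criterion.\<close>

lemma kannappan_exponential_pair:
  assumes \<sigma>: "involutive_automorphism \<sigma>" and \<mu>: "exponential \<mu>"
    and f: "\<And>x. f x = a * \<mu> x + b * \<mu> (\<sigma> x)" and g: "\<And>x. g x = c * \<mu> x + d * \<mu> (\<sigma> x)"
    and z: "a * \<mu> z = a * d - b * c" "b * \<mu> (\<sigma> z) = - (a * d - b * c)"
  shows "kannappan_sine_subtraction \<sigma> z f g"
  unfolding kannappan_sine_subtraction_def
proof (intro allI)
  fix x y
  have "f (x * \<sigma> y * z) = a * \<mu> z * \<mu> x * \<mu> (\<sigma> y) + b * \<mu> (\<sigma> z) * \<mu> (\<sigma> x) * \<mu> y"
    by (simp add: f involutive_automorphismD[OF \<sigma>] exponentialD[OF \<mu>] mult_ac)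
  also have "\<dots> = f x * g y - f y * g x"
    unfolding z f g by (simp add: algebra_simps)
  finally show "f (x * \<sigma> y * z) = f x * g y - f y * g x" .
qed

text \<open>Converse of \<open>kannappan_exponential_pair\<close>: for fixed \<open>y\<close>, the
  coefficients of \<open>\<mu> x\<close> and \<open>\<mu> (\<sigma> x)\<close> in the equation are
  compared.\<close>

lemma exponential_pair_constraints:
  assumes \<sigma>: "involutive_automorphism \<sigma>" and eq: "kannappan_sine_subtraction \<sigma> z f g"
    and \<mu>: "exponential \<mu>" and ind: "lin_indep \<mu> (\<mu> \<circ> \<sigma>)"
    and f: "\<And>x. f x = a * \<mu> x + b * \<mu> (\<sigma> x)" and g: "\<And>x. g x = c * \<mu> x + d * \<mu> (\<sigma> x)"
  shows "a * \<mu> z = a * d - b * c" "b * \<mu> (\<sigma> z) = - (a * d - b * c)"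
proof -
  note E = eq[unfolded kannappan_sine_subtraction_def, rule_format]
  note [simp] = involutive_automorphismD[OF \<sigma>] exponentialD(1)[OF \<mu>]
  obtain y where y: "\<mu> y \<noteq> 0" using exponentialD(2)[OF \<mu>] by blast
  have *: "(a * \<mu> z * \<mu> (\<sigma> y)) * \<mu> x + (b * \<mu> (\<sigma> z) * \<mu> y) * (\<mu> \<circ> \<sigma>) x =
    ((a * d - b * c) * \<mu> (\<sigma> y)) * \<mu> x + (- (a * d - b * c) * \<mu> y) * (\<mu> \<circ> \<sigma>) x" for x y
    using E[of x y] unfolding f g by (simp add: algebra_simps)
  \<comment> \<open>One \<open>y\<close> serves both comparisons: the first is taken at
    \<open>\<sigma> y\<close>, where its factor is
    \<open>\<mu> (\<sigma> (\<sigma> y)) = \<mu> y\<close>.\<close>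
  show "a * \<mu> z = a * d - b * c" "b * \<mu> (\<sigma> z) = - (a * d - b * c)"
    using lin_indep_coeff_eq(1)[OF ind *[of "\<sigma> y"]] lin_indep_coeff_eq(2)[OF ind *[of y]] y
    by simp_all
qed

text \<open>Written in \<open>\<mu> + \<mu> \<circ> \<sigma>\<close> and
  \<open>\<mu> - \<mu> \<circ> \<sigma>\<close>, the even coefficients of \<open>f\<close> and
  \<open>g\<close> are \<open>(a + b) / 2\<close> and \<open>(c + d) / 2\<close>. The family depends
  on which of them vanishes: that of \<open>g\<close> (family 3), that of \<open>f\<close> (family
  4) or neither (family 5). Both cannot vanish because of \<open>det\<close>.\<close>

lemma exponential_pair_families:
  assumes \<mu>: "exponential \<mu>" "\<mu> \<noteq> \<mu> \<circ> \<sigma>"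
    and f: "\<And>x. f x = a * \<mu> x + b * \<mu> (\<sigma> x)" and g: "\<And>x. g x = c * \<mu> x + d * \<mu> (\<sigma> x)"
    and z: "a * \<mu> z = a * d - b * c" "b * \<mu> (\<sigma> z) = - (a * d - b * c)"
    and det: "a * d - b * c \<noteq> 0"
  shows "(\<exists>\<gamma> b c \<mu>. family3 \<sigma> z f g \<gamma> b c \<mu>) \<or> (\<exists>\<beta> b c \<mu>. family4 \<sigma> z f g \<beta> b c \<mu>)
    \<or> (\<exists>\<alpha> \<delta> b c \<mu>. family5 \<sigma> z f g \<alpha> \<delta> b c \<mu>)"
proof -
  have ab: "a \<noteq> 0" "b \<noteq> 0" using z det by auto
  have \<mu>z: "\<mu> z = (a * d - b * c) / a" "(\<mu> \<circ> \<sigma>) z = - (a * d - b * c) / b"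
    using z ab by (simp_all add: field_simps)
  consider "c + d = 0" | "c + d \<noteq> 0" "a + b = 0" | "c + d \<noteq> 0" "a + b \<noteq> 0" by blast
  then show ?thesis
  proof cases
    case 1
    then have d: "d = - c" by (simp add: add_eq_0_iff)
    with det have "a * c + b * c \<noteq> 0" by (simp add: neg_eq_iff_add_eq_0)
    then have s: "a + b \<noteq> 0" "c \<noteq> 0" by (auto simp flip: distrib_right)
    \<comment> \<open>The quotient of the odd and the even coefficient of \<open>f\<close>, the
      constant \<open>c\<close> of family 3.\<close>
    define r where "r = (a - b) / (a + b)"
    have r: "1 + r = 2 * a / (a + b)" "1 - r = 2 * b / (a + b)"
      using s by (simp_all add: r_def field_simps)
    have "r \<noteq> 1" "r \<noteq> - 1"
      using r ab s by (auto simp: field_simps)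
    moreover have "\<mu> z = - 2 * c / (1 + r)" "(\<mu> \<circ> \<sigma>) z = 2 * c / (1 - r)"
      unfolding \<mu>z r d using ab s by (simp_all add: field_simps)
    moreover have "f x = (\<mu> x + (\<mu> \<circ> \<sigma>) x) / (2 * (1 / (a + b)))
        + r * ((\<mu> x - (\<mu> \<circ> \<sigma>) x) / (2 * (1 / (a + b))))" for x
      unfolding f r_def using s by (simp add: divide_simps) (simp add: algebra_simps)
    moreover have "g x = c * (\<mu> x - (\<mu> \<circ> \<sigma>) x)" for x
      by (simp add: g d algebra_simps)
    ultimately have "family3 \<sigma> z f g (1 / (a + b)) c r \<mu>"
      using \<mu> s unfolding family3_def by auto
    then show ?thesis by blast
  next
    case 2
    then have b: "b = - a" by (simp add: add_eq_0_iff)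
    have "\<mu> z = 1 / (1 / (c + d))" "(\<mu> \<circ> \<sigma>) z = 1 / (1 / (c + d))"
      unfolding \<mu>z b using ab by (simp_all add: field_simps)
    moreover have "f x = a * (\<mu> x - (\<mu> \<circ> \<sigma>) x)" for x
      by (simp add: f b algebra_simps)
    moreover have "g x = (\<mu> x + (\<mu> \<circ> \<sigma>) x) / (2 * (1 / (c + d)))
        + ((c - d) / (c + d)) * ((\<mu> x - (\<mu> \<circ> \<sigma>) x) / (2 * (1 / (c + d))))" for x
      unfolding g using 2 by (simp add: divide_simps) (simp add: algebra_simps)
    ultimately have "family4 \<sigma> z f g (1 / (c + d)) a ((c - d) / (c + d)) \<mu>"
      using \<mu> ab 2 unfolding family4_def by auto
    then show ?thesis by blast
  next
    case 3
    \<comment> \<open>\<open>\<delta>\<close> and \<open>r\<close> are read off from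
      \<open>g\<close>, and \<open>\<alpha>\<close> from the even part of \<open>f\<close>. The
      constant \<open>e\<close>, the \<open>b\<close> of family 5, is what the odd part of
      \<open>f\<close> then requires, as \<open>k\<close> confirms.\<close>
    define \<alpha> \<delta> r e where "\<alpha> = (a + b) / (c + d)" and "\<delta> = 1 / (c + d)"
      and "r = (c - d) / (c + d)" and "e = (a * d - b * c) / (c + d)"
    have nz: "\<alpha> \<noteq> 0" "\<delta> \<noteq> 0" "e \<noteq> 0" using 3 det by (simp_all add: \<alpha>_def \<delta>_def e_def)
    have k: "\<alpha> * r + 2 * e * \<delta> = (a - b) / (c + d)"
      using 3 by (simp add: \<alpha>_def \<delta>_def r_def e_def divide_simps) (simp add: algebra_simps)
    have s: "\<alpha> * (1 + r) + 2 * e * \<delta> = 2 * a / (c + d)"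
      "\<alpha> * (r - 1) + 2 * e * \<delta> = - 2 * b / (c + d)"
    proof -
      have "\<alpha> * (1 + r) + 2 * e * \<delta> = (a - b) / (c + d) + \<alpha>"
        "\<alpha> * (r - 1) + 2 * e * \<delta> = (a - b) / (c + d) - \<alpha>"
        unfolding k[symmetric] by (simp_all add: algebra_simps)
      then show "\<alpha> * (1 + r) + 2 * e * \<delta> = 2 * a / (c + d)"
        "\<alpha> * (r - 1) + 2 * e * \<delta> = - 2 * b / (c + d)"
        by (simp_all add: \<alpha>_def diff_divide_distrib[symmetric] add_divide_distrib[symmetric])
    qed
    have nz': "\<alpha> * (1 + r) + 2 * e * \<delta> \<noteq> 0" "\<alpha> * (r - 1) + 2 * e * \<delta> \<noteq> 0"
      unfolding s using ab 3 by simp_all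
    \<comment> \<open>Equality in either case would make a denominator in \<open>nz'\<close> vanish,
      that is, \<open>b = 0\<close> or \<open>a = 0\<close>.\<close>
    have "\<alpha> \<noteq> 2 * e * \<delta> + \<alpha> * r" "\<alpha> \<noteq> - (2 * e * \<delta> + \<alpha> * r)"
    proof -
      have "\<alpha> * (r - 1) + 2 * e * \<delta> = 2 * e * \<delta> + \<alpha> * r - \<alpha>"
        "\<alpha> * (1 + r) + 2 * e * \<delta> = \<alpha> - - (2 * e * \<delta> + \<alpha> * r)"
        by (simp_all add: algebra_simps)
      with nz' show "\<alpha> \<noteq> 2 * e * \<delta> + \<alpha> * r" "\<alpha> \<noteq> - (2 * e * \<delta> + \<alpha> * r)"
        by (metis right_minus_eq)+
    qed
    moreover have "\<mu> z = 2 * e / (\<alpha> * (1 + r) + 2 * e * \<delta>)"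
      "(\<mu> \<circ> \<sigma>) z = 2 * e / (\<alpha> * (r - 1) + 2 * e * \<delta>)"
    proof -
      have cancel: "2 * (D / S) / (2 * a / S) = D / a" "2 * (D / S) / (- 2 * b / S) = - D / b"
        if "S \<noteq> 0" for D S :: complex
        using that ab by (simp_all add: field_simps)
      show "\<mu> z = 2 * e / (\<alpha> * (1 + r) + 2 * e * \<delta>)"
        unfolding \<mu>z s unfolding e_def by (rule cancel(1)[OF 3(1), symmetric])
      show "(\<mu> \<circ> \<sigma>) z = 2 * e / (\<alpha> * (r - 1) + 2 * e * \<delta>)"
        unfolding \<mu>z s unfolding e_def by (rule cancel(2)[OF 3(1), symmetric])
    qed
    moreover have "f x = \<alpha> * ((\<mu> x + (\<mu> \<circ> \<sigma>) x) / (2 * \<delta>))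
        + (\<alpha> * r + 2 * e * \<delta>) * ((\<mu> x - (\<mu> \<circ> \<sigma>) x) / (2 * \<delta>))" for x
      unfolding k unfolding f \<alpha>_def \<delta>_def using 3 by (simp add: divide_simps) (simp add: algebra_simps)
    moreover have "g x = (\<mu> x + (\<mu> \<circ> \<sigma>) x) / (2 * \<delta>) + r * ((\<mu> x - (\<mu> \<circ> \<sigma>) x) / (2 * \<delta>))" for x
      unfolding g \<delta>_def r_def using 3 by (simp add: divide_simps) (simp add: algebra_simps)
    ultimately have "family5 \<sigma> z f g \<alpha> \<delta> e r \<mu>"
      using \<mu> nz unfolding family5_def by auto
    then show ?thesis by blast
  qed
qed

lemma family3_kannappan:
  assumes \<sigma>: "involutive_automorphism \<sigma>" and fam: "family3 \<sigma> z f g \<gamma> b c \<mu>"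
  shows "kannappan_sine_subtraction \<sigma> z f g"
proof -
  note F = fam[unfolded family3_def]
  have nz: "\<gamma> \<noteq> 0" "1 + c \<noteq> 0" "1 - c \<noteq> 0" using F by (auto simp: add_eq_0_iff)
  have \<mu>z: "\<mu> z = - 2 * b / (1 + c)" "\<mu> (\<sigma> z) = 2 * b / (1 - c)" using F by simp_all
  show ?thesis
  proof (rule kannappan_exponential_pair[OF \<sigma>])
    show "exponential \<mu>" using F by blast
    show "f x = (1 + c) / (2 * \<gamma>) * \<mu> x + (1 - c) / (2 * \<gamma>) * \<mu> (\<sigma> x)" for x
      using F nz by (simp add: field_simps)
    show "g x = b * \<mu> x + (- b) * \<mu> (\<sigma> x)" for x
      using F by (simp add: algebra_simps)
  qed (unfold \<mu>z, use nz in \<open>simp_all add: divide_simps\<close>, simp_all add: algebra_simps)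
qed

lemma family4_kannappan:
  assumes \<sigma>: "involutive_automorphism \<sigma>" and fam: "family4 \<sigma> z f g \<beta> b c \<mu>"
  shows "kannappan_sine_subtraction \<sigma> z f g"
proof -
  note F = fam[unfolded family4_def]
  have nz: "\<beta> \<noteq> 0" using F by blast
  have \<mu>z: "\<mu> z = 1 / \<beta>" "\<mu> (\<sigma> z) = 1 / \<beta>" using F by simp_all
  show ?thesis
  proof (rule kannappan_exponential_pair[OF \<sigma>])
    show "exponential \<mu>" using F by blast
    show "f x = b * \<mu> x + (- b) * \<mu> (\<sigma> x)" for x
      using F by (simp add: algebra_simps)
    show "g x = (1 + c) / (2 * \<beta>) * \<mu> x + (1 - c) / (2 * \<beta>) * \<mu> (\<sigma> x)" for x
      using F nz by (simp add: field_simps)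
  qed (unfold \<mu>z, use nz in \<open>simp_all add: divide_simps\<close>, simp_all add: algebra_simps)
qed

lemma family5_kannappan:
  assumes \<sigma>: "involutive_automorphism \<sigma>" and fam: "family5 \<sigma> z f g \<alpha> \<delta> b c \<mu>"
  shows "kannappan_sine_subtraction \<sigma> z f g"
proof -
  note F = fam[unfolded family5_def]
  \<comment> \<open>The denominators of the prescribed values at \<open>z\<close>. Up to the factor
    \<open>2 * \<delta>\<close>, \<open>p\<close> and \<open>- q\<close> are also the coefficients
    of \<open>\<mu>\<close> and \<open>\<mu> \<circ> \<sigma>\<close> in \<open>f\<close>.\<close>
  define p q where "p = \<alpha> * (1 + c) + 2 * b * \<delta>" and "q = \<alpha> * (c - 1) + 2 * b * \<delta>"
  have "\<alpha> \<noteq> 2 * b * \<delta> + \<alpha> * c" "\<alpha> \<noteq> - (2 * b * \<delta> + \<alpha> * c)" using F by blast+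
  then have nz: "p \<noteq> 0" "q \<noteq> 0"
    unfolding p_def q_def by (auto simp: algebra_simps eq_neg_iff_add_eq_0)
  have \<delta>: "\<delta> \<noteq> 0" using F by blast
  have \<mu>z: "\<mu> z = 2 * b / p" "\<mu> (\<sigma> z) = 2 * b / q" using F by (simp_all add: p_def q_def)
  have det: "p / (2 * \<delta>) * ((1 - c) / (2 * \<delta>)) - (- q / (2 * \<delta>)) * ((1 + c) / (2 * \<delta>)) = b / \<delta>"
    using \<delta> unfolding p_def q_def by (simp add: divide_simps) (simp add: algebra_simps)
  show ?thesis
  proof (rule kannappan_exponential_pair[OF \<sigma>])
    show "exponential \<mu>" using F by blast
    show "f x = p / (2 * \<delta>) * \<mu> x + (- q / (2 * \<delta>)) * \<mu> (\<sigma> x)" for x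
      using F \<delta> by (simp add: p_def q_def field_simps)
    show "g x = (1 + c) / (2 * \<delta>) * \<mu> x + (1 - c) / (2 * \<delta>) * \<mu> (\<sigma> x)" for x
      using F \<delta> by (simp add: field_simps)
  qed (unfold \<mu>z det, use nz \<delta> in \<open>simp_all add: divide_simps\<close>)
qed

section \<open>The set \<open>P_set\<close> and the functions \<open>Psi\<close>: families 6 and
  7\<close>

lemma P_set_iff:
  "p \<in> P_set \<mu> \<longleftrightarrow> p \<in> null_space \<mu> - set_square (null_space \<mu>) \<and>
    (\<forall>u v. \<mu> u \<noteq> 0 \<longrightarrow> \<mu> v \<noteq> 0 \<longrightarrow> {u * p, p * v, u * p * v} \<subseteq> null_space \<mu> - set_square (null_space \<mu>))"
  unfolding P_set_def Let_def null_space_def by auto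

text \<open>\<open>\<sigma>\<close> preserves the null space, its complement and its square, so the
  condition on \<open>\<sigma> p\<close> with \<open>u\<close>, \<open>v\<close> is the image of the
  one on \<open>p\<close> with \<open>\<sigma> u\<close>, \<open>\<sigma> v\<close>.\<close>

lemma P_set_automorphism:
  assumes \<sigma>: "involutive_automorphism \<sigma>" and \<mu>: "\<mu> \<circ> \<sigma> = \<mu>" and p: "p \<in> P_set \<mu>"
  shows "\<sigma> p \<in> P_set \<mu>"
proof -
  note S = involutive_automorphismD[OF \<sigma>]
  have \<mu>': "\<mu> (\<sigma> x) = \<mu> x" for x using fun_cong[OF \<mu>, of x] by simp
  let ?J = "null_space \<mu> - set_square (null_space \<mu>)"
  have J: "\<sigma> x \<in> ?J" if "x \<in> ?J" for x
  proof -
    have "\<sigma> x \<notin> set_square (null_space \<mu>)"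
    proof
      assume "\<sigma> x \<in> set_square (null_space \<mu>)"
      then obtain a b where "\<sigma> x = a * b" "\<mu> a = 0" "\<mu> b = 0"
        unfolding set_square_def null_space_def by auto
      then have "x = \<sigma> a * \<sigma> b" "\<mu> (\<sigma> a) = 0" "\<mu> (\<sigma> b) = 0" using S \<mu>' by metis+
      then show False using that unfolding set_square_def null_space_def by auto
    qed
    then show ?thesis using that \<mu>' by (simp add: null_space_def)
  qed
  have "\<sigma> p \<in> ?J" using J p P_set_iff by blast
  moreover have "{u * \<sigma> p, \<sigma> p * v, u * \<sigma> p * v} \<subseteq> ?J" if "\<mu> u \<noteq> 0" "\<mu> v \<noteq> 0" for u v
  proof -
    have "{\<sigma> u * p, p * \<sigma> v, \<sigma> u * p * \<sigma> v} \<subseteq> ?J"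
      using p that \<mu>' unfolding P_set_iff by metis
    then have "{\<sigma> (\<sigma> u * p), \<sigma> (p * \<sigma> v), \<sigma> (\<sigma> u * p * \<sigma> v)} \<subseteq> ?J" using J by auto
    then show ?thesis by (simp add: S)
  qed
  ultimately show ?thesis unfolding P_set_iff by blast
qed

text \<open>By associativity a further factor on the side of \<open>u\<close> only replaces
  \<open>u\<close> by a product, which again lies outside the null space.\<close>

lemma P_set_mult:
  assumes \<mu>: "exponential \<mu>" and p: "p \<in> P_set \<mu>" and u: "\<mu> u \<noteq> 0"
  shows "u * p \<in> P_set \<mu>" "p * u \<in> P_set \<mu>"
proof -
  have nz: "\<mu> (x * y) \<noteq> 0" if "\<mu> x \<noteq> 0" "\<mu> y \<noteq> 0" for x y
    using that by (simp add: exponentialD[OF \<mu>])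
  have P: "{a * p, p * b, a * p * b} \<subseteq> null_space \<mu> - set_square (null_space \<mu>)"
    if "\<mu> a \<noteq> 0" "\<mu> b \<noteq> 0" for a b
    using p that unfolding P_set_iff by blast
  show "u * p \<in> P_set \<mu>"
    unfolding P_set_iff using P[OF u] P[OF nz[OF _ u]] u by (simp add: mult.assoc)
  show "p * u \<in> P_set \<mu>"
    unfolding P_set_iff using P[OF _ u] P[OF _ nz[OF u]] u by (simp add: mult.assoc)
qed

text \<open>The conditions on \<open>Psi\<close> are exactly the mixed cases of the law, with one
  factor in the null space. Outside the null space the law is additivity of \<open>A\<close>. For
  two factors in the null space the product lies in its square, hence outside \<open>P_set\<close>,
  and both sides are 0.\<close>

lemma Psi_addition_law:
  assumes \<mu>: "exponential \<mu>" and A: "additive_on (- null_space \<mu>) A" and \<Psi>: "Psi_conditions \<mu> A \<rho>"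
  shows "Psi \<mu> A \<rho> (x * y) = Psi \<mu> A \<rho> x * \<mu> y + Psi \<mu> A \<rho> y * \<mu> x"
proof -
  note M = exponentialD(1)[OF \<mu>]
  have N: "x \<in> null_space \<mu> \<longleftrightarrow> \<mu> x = 0" for x by (simp add: null_space_def)
  have P0: "\<mu> p = 0" if "p \<in> P_set \<mu>" for p using that by (simp add: P_set_iff N)
  have \<Psi>0: "Psi \<mu> A \<rho> (a * b) = 0 \<and> Psi \<mu> A \<rho> (b * a) = 0"
    if "\<mu> a = 0" "a \<notin> P_set \<mu>" "\<mu> b \<noteq> 0" for a b
  proof -
    have "a \<in> null_space \<mu> - P_set \<mu>" "b \<in> - null_space \<mu>" using that by (simp_all add: N)
    then show ?thesis using \<Psi> unfolding Psi_conditions_def by blast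
  qed
  have \<Psi>P: "\<rho> (u * p) = \<rho> p * \<mu> u" "\<rho> (p * u) = \<rho> p * \<mu> u" if "p \<in> P_set \<mu>" "\<mu> u \<noteq> 0" for p u
  proof -
    have "u \<in> - null_space \<mu>" using that by (simp add: N)
    then show "\<rho> (u * p) = \<rho> p * \<mu> u" "\<rho> (p * u) = \<rho> p * \<mu> u"
      using \<Psi> that(1) unfolding Psi_conditions_def by blast+
  qed
  consider "\<mu> x \<noteq> 0" "\<mu> y \<noteq> 0" | "\<mu> x = 0" "\<mu> y = 0" | "\<mu> x = 0" "\<mu> y \<noteq> 0" | "\<mu> x \<noteq> 0" "\<mu> y = 0"
    by blast
  then show ?thesis
  proof cases
    case 1
    then have "A (x * y) = A x + A y" using A by (simp add: additive_on_def N)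
    with 1 show ?thesis by (simp add: Psi_def N M algebra_simps)
  next
    case 2
    then have "x * y \<in> set_square (null_space \<mu>)" by (auto simp: set_square_def N)
    then have "x * y \<notin> P_set \<mu>" by (simp add: P_set_iff)
    with 2 show ?thesis by (simp add: Psi_def N M)
  next
    case 3
    show ?thesis
    proof (cases "x \<in> P_set \<mu>")
      case True
      with 3 show ?thesis using P_set_mult(2)[OF \<mu> True] by (simp add: Psi_def N M \<Psi>P)
    next
      case False
      with 3 show ?thesis using \<Psi>0[of x y] by (simp add: Psi_def N)
    qed
  next
    case 4
    show ?thesis
    proof (cases "y \<in> P_set \<mu>")
      case True
      with 4 show ?thesis using P_set_mult(1)[OF \<mu> True] by (simp add: Psi_def N M \<Psi>P)
    next
      case False
      with 4 show ?thesis using \<Psi>0[of y x] by (simp add: Psi_def N)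
    qed
  qed
qed

lemma Psi_odd:
  assumes \<sigma>: "involutive_automorphism \<sigma>" and \<mu>: "\<mu> \<circ> \<sigma> = \<mu>"
    and A: "odd_on (- null_space \<mu>) \<sigma> A" and \<rho>: "odd_on (P_set \<mu>) \<sigma> \<rho>"
  shows "Psi \<mu> A \<rho> (\<sigma> x) = - Psi \<mu> A \<rho> x"
proof -
  have \<mu>': "\<mu> (\<sigma> x) = \<mu> x" for x using fun_cong[OF \<mu>, of x] by simp
  have "\<sigma> x \<in> P_set \<mu> \<longleftrightarrow> x \<in> P_set \<mu>"
    using P_set_automorphism[OF \<sigma> \<mu>] involutive_automorphismD(2)[OF \<sigma>] by metis
  then show ?thesis
    using A \<rho> by (simp add: Psi_def null_space_def \<mu>' odd_on_def)
qed

text \<open>The law makes \<open>k\<close> vanish on products of two elements of the null space, and hence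
  off \<open>P\<close>, since multiplication by elements outside the null space only scales \<open>k\<close>.\<close>

lemma sine_addition_law_Psi:
  assumes \<mu>: "exponential \<mu>" and k: "\<And>x y. k (x * y) = k x * \<mu> y + k y * \<mu> x"
  shows "k = Psi \<mu> (\<lambda>x. k x / \<mu> x) k"
    and "additive_on (- null_space \<mu>) (\<lambda>x. k x / \<mu> x)"
    and "Psi_conditions \<mu> (\<lambda>x. k x / \<mu> x) k"
proof -
  note M = exponentialD(1)[OF \<mu>]
  have sq: "k x = 0" if "x \<in> set_square (null_space \<mu>)" for x
    using that k by (auto simp: set_square_def null_space_def)
  have off: "k x = 0" if x: "\<mu> x = 0" "x \<notin> P_set \<mu>" for x
  proof (cases "x \<in> set_square (null_space \<mu>)")
    case False
    with x obtain u v where uv: "\<mu> u \<noteq> 0" "\<mu> v \<noteq> 0"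
      and "\<not> {u * x, x * v, u * x * v} \<subseteq> null_space \<mu> - set_square (null_space \<mu>)"
      unfolding P_set_iff null_space_def by auto
    \<comment> \<open>All these products lie in the null space because \<open>\<mu> x = 0\<close>;
      so one of them lies in its square, where \<open>k\<close> vanishes. It equals \<open>x\<close>
      up to factors that scale \<open>k x\<close> by nonzero numbers.\<close>
    then have "k (u * x) = 0 \<or> k (x * v) = 0 \<or> k (u * x * v) = 0"
      using sq x(1) by (auto simp: null_space_def M)
    then show ?thesis using uv x(1) by (auto simp: k M)
  qed (rule sq)
  show eq: "k = Psi \<mu> (\<lambda>x. k x / \<mu> x) k"
    by (rule ext) (use off in \<open>simp add: Psi_def null_space_def\<close>)
  show "additive_on (- null_space \<mu>) (\<lambda>x. k x / \<mu> x)"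
    by (simp add: additive_on_def null_space_def k M field_simps)
  have "k (x * y) = 0 \<and> k (y * x) = 0" if "x \<in> null_space \<mu> - P_set \<mu>" for x y
    using that off[of x] by (simp add: k null_space_def)
  moreover have "\<mu> p = 0" if "p \<in> P_set \<mu>" for p
    using that by (simp add: P_set_iff null_space_def)
  ultimately show "Psi_conditions \<mu> (\<lambda>x. k x / \<mu> x) k"
    unfolding Psi_conditions_def eq[symmetric] by (simp add: k M mult.commute)
qed

text \<open>The determinant of \<open>f\<close>, \<open>g\<close> at \<open>x\<close>,
  \<open>y\<close> is \<open>b * c - a * d\<close> times
  \<open>k x * \<mu> y - k y * \<mu> x\<close>. The first condition in \<open>z\<close> matches this
  coefficient, and the second removes the remaining term in
  \<open>\<mu> x * \<mu> y\<close>.\<close>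

lemma kannappan_sine_pair:
  assumes \<sigma>: "involutive_automorphism \<sigma>" and \<mu>: "exponential \<mu>"
    and even: "\<And>x. \<mu> (\<sigma> x) = \<mu> x" and odd: "\<And>x. k (\<sigma> x) = - k x"
    and k: "\<And>x y. k (x * y) = k x * \<mu> y + k y * \<mu> x"
    and f: "\<And>x. f x = a * \<mu> x + b * k x" and g: "\<And>x. g x = c * \<mu> x + d * k x"
    and z: "b * \<mu> z = b * c - a * d" "a * \<mu> z + b * k z = 0"
  shows "kannappan_sine_subtraction \<sigma> z f g"
  unfolding kannappan_sine_subtraction_def
proof (intro allI)
  fix x y
  have "f (x * \<sigma> y * z) = (a * \<mu> z + b * k z) * \<mu> x * \<mu> y + b * \<mu> z * (k x * \<mu> y - k y * \<mu> x)"
    by (simp add: f k exponentialD[OF \<mu>] even odd algebra_simps)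
  also have "\<dots> = f x * g y - f y * g x"
    unfolding z f g by (simp add: algebra_simps)
  finally show "f (x * \<sigma> y * z) = f x * g y - f y * g x" .
qed

text \<open>Converse of \<open>kannappan_sine_pair\<close>, by comparing the coefficients of
  \<open>\<mu> x\<close> and \<open>k x\<close> at a fixed \<open>y\<close>.\<close>

lemma sine_pair_constraints:
  assumes eq: "kannappan_sine_subtraction \<sigma> z f g" and \<mu>: "exponential \<mu>"
    and ind: "lin_indep \<mu> k"
    and even: "\<And>x. \<mu> (\<sigma> x) = \<mu> x" and odd: "\<And>x. k (\<sigma> x) = - k x"
    and k: "\<And>x y. k (x * y) = k x * \<mu> y + k y * \<mu> x"
    and f: "\<And>x. f x = a * \<mu> x + b * k x" and g: "\<And>x. g x = c * \<mu> x + d * k x"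
  shows "b * \<mu> z = b * c - a * d" "a * \<mu> z + b * k z = 0"
proof -
  note E = eq[unfolded kannappan_sine_subtraction_def, rule_format]
  obtain y where y: "\<mu> y \<noteq> 0" using exponentialD(2)[OF \<mu>] by blast
  have "((a * \<mu> z + b * k z) * \<mu> y - b * \<mu> z * k y) * \<mu> x + (b * \<mu> z * \<mu> y) * k x
    = (- (b * c - a * d) * k y) * \<mu> x + ((b * c - a * d) * \<mu> y) * k x" for x
    using E[of x y] unfolding f g by (simp add: k exponentialD[OF \<mu>] even odd algebra_simps)
  note coeffs = lin_indep_coeff_eq[OF ind this]
  show b: "b * \<mu> z = b * c - a * d" using coeffs(2) y by simp
  have "(a * \<mu> z + b * k z) * \<mu> y = 0" using coeffs(1) b by algebra
  then show "a * \<mu> z + b * k z = 0" using y by simp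
qed

text \<open>\<open>c = 0\<close> means that \<open>g\<close> is a multiple of \<open>k\<close> and
  leads to family 6; otherwise family 7 arises. Since both families prescribe values at
  \<open>z\<close>, \<open>k\<close> has to be rescaled to become the required
  \<open>Psi\<close>.\<close>

lemma sine_pair_families:
  assumes \<mu>: "exponential \<mu>" and nz: "\<exists>x. k x \<noteq> 0"
    and even: "\<And>x. \<mu> (\<sigma> x) = \<mu> x" and odd: "\<And>x. k (\<sigma> x) = - k x"
    and k: "\<And>x y. k (x * y) = k x * \<mu> y + k y * \<mu> x"
    and f: "\<And>x. f x = a * \<mu> x + b * k x" and g: "\<And>x. g x = c * \<mu> x + d * k x"
    and z: "b * \<mu> z = b * c - a * d" "a * \<mu> z + b * k z = 0"
    and det: "b * c - a * d \<noteq> 0"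
  shows "(\<exists>\<gamma> c \<mu> A \<rho>. family6 \<sigma> z f g \<gamma> c \<mu> A \<rho>)
    \<or> (\<exists>\<alpha> c \<delta> \<mu> A \<rho>. family7 \<sigma> z f g \<alpha> c \<delta> \<mu> A \<rho>)"
proof -
  have b: "b \<noteq> 0" and \<mu>z0: "\<mu> z \<noteq> 0" using z det by auto
  have \<mu>z: "\<mu> z = (b * c - a * d) / b" using z(1) b by (simp add: field_simps)
  have kz: "k z / \<mu> z = - a / b" using z(2) b \<mu>z0 by (simp add: field_simps eq_neg_iff_add_eq_0 add.commute)
  \<comment> \<open>In family 6, \<open>g = Psi\<close> forces the scale \<open>d\<close>. In family
    7, matching coefficients together with the prescribed value of \<open>\<mu> z\<close> forces
    \<open>(b * c - a * d) / c\<close>.\<close>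
  define t where "t = (if c = 0 then d else (b * c - a * d) / c)"
  have t: "t \<noteq> 0" using det by (auto simp: t_def)
  define K where "K x = t * k x" for x
  define A where "A x = K x / \<mu> x" for x
  have K: "K (x * y) = K x * \<mu> y + K y * \<mu> x" for x y by (simp add: K_def k algebra_simps)
  note \<Psi> = sine_addition_law_Psi[of \<mu> K, OF \<mu> K, folded A_def[abs_def]]
  have Az: "A z = - t * a / b" 
  proof -
    have "A z = t * (k z / \<mu> z)" by (simp add: A_def K_def)
    then show ?thesis unfolding kz by simp
  qed
  have sym: "\<mu> \<circ> \<sigma> = \<mu>" "odd_on (- null_space \<mu>) \<sigma> A" "odd_on (P_set \<mu>) \<sigma> K"
    by (auto simp: odd_on_def A_def K_def even odd)
  show ?thesis
  proof (cases "c = 0")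
    case True
    then have td: "t = d" and a: "a \<noteq> 0" using det by (auto simp: t_def)
    have "z \<in> - null_space \<mu>" "A z \<noteq> 0" using \<mu>z0 Az t a b by (simp_all add: null_space_def)
    then have "nonzero_on (- null_space \<mu>) A" unfolding nonzero_on_def by blast
    moreover have "f x = a * (\<mu> x + b / (a * d) * Psi \<mu> A K x)" for x
      unfolding \<Psi>(1)[symmetric] K_def td f using a t td by (simp add: field_simps)
    moreover have "g = Psi \<mu> A K"
      unfolding \<Psi>(1)[symmetric] by (simp add: K_def[abs_def] td g[abs_def] True)
    moreover have "\<mu> z = - 1 / (b / (a * d))" "A z = - 1 / (b / (a * d))"
      unfolding \<mu>z Az True td using a b t td by simp_all
    ultimately have "family6 \<sigma> z f g a (b / (a * d)) \<mu> A K"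
      unfolding family6_def using a b t td \<mu> \<Psi>(2,3) sym by auto
    then show ?thesis by blast
  next
    case False
    then have tc: "t = (b * c - a * d) / c" by (simp add: t_def)
    \<comment> \<open>Obtained by matching the coefficients of \<open>\<mu>\<close> in
      \<open>f\<close> and \<open>g\<close> and that of \<open>K\<close> in \<open>g\<close>;
      \<open>s\<close> gives the remaining coefficient.\<close>
    define \<alpha> e \<delta> where "\<alpha> = a / c" and "e = d / (c * t)" and "\<delta> = 1 / c"
    have s: "\<alpha> * e + \<delta> = b / (c * t)"
    proof -
      have "\<alpha> * e + \<delta> = (a * d + c * t) / (c * c * t)"
        using False t by (simp add: \<alpha>_def e_def \<delta>_def field_simps)
      also have "a * d + c * t = c * b" using False by (simp add: tc)
      finally show ?thesis using False by simp
    qed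
    \<comment> \<open>\<open>A z\<close> is zero when \<open>a = 0\<close>, so the argument uses
      only that \<open>K\<close> is nonzero somewhere: off the null space this concerns
      \<open>A\<close>, on \<open>P_set\<close> it concerns \<open>K\<close> in the role of
      \<open>\<rho>\<close>.\<close>
    obtain x where "K x \<noteq> 0" using nz t by (auto simp: K_def)
    then have "nonzero_on (- null_space \<mu>) A \<or> nonzero_on (P_set \<mu>) K"
      using fun_cong[OF \<Psi>(1), of x] unfolding nonzero_on_def Psi_def
      by (metis mult_eq_0_iff)
    moreover have "f x = 1 / \<delta> * (\<alpha> * \<mu> x + (\<alpha> * e + \<delta>) * Psi \<mu> A K x)" for x
      unfolding \<Psi>(1)[symmetric] s unfolding K_def f \<alpha>_def \<delta>_def using False t by (simp add: field_simps)
    moreover have "g x = 1 / \<delta> * (\<mu> x + e * Psi \<mu> A K x)" for x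
      unfolding \<Psi>(1)[symmetric] K_def g e_def \<delta>_def using False t by (simp add: field_simps)
    moreover have "\<mu> z = 1 / (\<alpha> * e + \<delta>)" "A z = - \<alpha> / (\<alpha> * e + \<delta>)"
      unfolding \<mu>z Az s unfolding \<alpha>_def using False by (simp_all add: tc)
    moreover have "\<delta> \<noteq> 0" "\<alpha> * e + \<delta> \<noteq> 0"
      unfolding s using False b t by (simp_all add: \<delta>_def)
    ultimately have "family7 \<sigma> z f g \<alpha> e \<delta> \<mu> A K"
      unfolding family7_def using \<mu> \<Psi>(2,3) sym by auto
    then show ?thesis by blast
  qed
qed

lemma family6_kannappan:
  assumes \<sigma>: "involutive_automorphism \<sigma>" and fam: "family6 \<sigma> z f g \<gamma> c \<mu> A \<rho>"
  shows "kannappan_sine_subtraction \<sigma> z f g"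
proof -
  note F = fam[unfolded family6_def]
  have \<mu>: "exponential \<mu>" and c: "c \<noteq> 0" and sym: "\<mu> \<circ> \<sigma> = \<mu>" and \<mu>z: "\<mu> z = - 1 / c" using F by blast+
  have \<Psi>z: "Psi \<mu> A \<rho> z = 1 / c * (1 / c)" using F by (simp add: Psi_def null_space_def)
  show ?thesis
  proof (rule kannappan_sine_pair[where k = "Psi \<mu> A \<rho>", OF \<sigma> \<mu>])
    show "\<mu> (\<sigma> x) = \<mu> x" for x using fun_cong[OF sym, of x] by simp
    show "Psi \<mu> A \<rho> (\<sigma> x) = - Psi \<mu> A \<rho> x" for x
      by (rule Psi_odd[OF \<sigma>]) (use F in blast)+
    show "Psi \<mu> A \<rho> (x * y) = Psi \<mu> A \<rho> x * \<mu> y + Psi \<mu> A \<rho> y * \<mu> x" for x y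
      by (rule Psi_addition_law[OF \<mu>]) (use F in blast)+
    show "f x = \<gamma> * \<mu> x + (\<gamma> * c) * Psi \<mu> A \<rho> x" for x
      using F by (simp add: algebra_simps)
    show "g x = 0 * \<mu> x + 1 * Psi \<mu> A \<rho> x" for x using F by simp
  qed (use c in \<open>simp_all add: \<mu>z \<Psi>z\<close>)
qed

lemma family7_kannappan:
  assumes \<sigma>: "involutive_automorphism \<sigma>" and fam: "family7 \<sigma> z f g \<alpha> c \<delta> \<mu> A \<rho>"
  shows "kannappan_sine_subtraction \<sigma> z f g"
proof -
  note F = fam[unfolded family7_def]
  define s where "s = \<alpha> * c + \<delta>"
  have \<mu>: "exponential \<mu>" and nz: "\<delta> \<noteq> 0" "s \<noteq> 0" and sym: "\<mu> \<circ> \<sigma> = \<mu>"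
    and \<mu>z: "\<mu> z = 1 / s" using F by (simp_all add: s_def)
  have \<Psi>z: "Psi \<mu> A \<rho> z = - \<alpha> / s * (1 / s)" using F by (simp add: Psi_def null_space_def s_def)
  have det: "s / \<delta> * (1 / \<delta>) - \<alpha> / \<delta> * (c / \<delta>) = 1 / \<delta>"
    using nz by (simp add: divide_simps) (simp add: s_def algebra_simps)
  show ?thesis
  proof (rule kannappan_sine_pair[where k = "Psi \<mu> A \<rho>", OF \<sigma> \<mu>])
    show "\<mu> (\<sigma> x) = \<mu> x" for x using fun_cong[OF sym, of x] by simp
    show "Psi \<mu> A \<rho> (\<sigma> x) = - Psi \<mu> A \<rho> x" for x
      by (rule Psi_odd[OF \<sigma>]) (use F in blast)+
    show "Psi \<mu> A \<rho> (x * y) = Psi \<mu> A \<rho> x * \<mu> y + Psi \<mu> A \<rho> y * \<mu> x" for x y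
      by (rule Psi_addition_law[OF \<mu>]) (use F in blast)+
    show "f x = (\<alpha> / \<delta>) * \<mu> x + (s / \<delta>) * Psi \<mu> A \<rho> x" for x
      using F by (simp add: s_def[symmetric] add_divide_distrib)
    show "g x = (1 / \<delta>) * \<mu> x + (c / \<delta>) * Psi \<mu> A \<rho> x" for x
      using F by (simp add: add_divide_distrib)
  qed (unfold \<mu>z \<Psi>z det, use nz in \<open>simp_all add: field_simps\<close>)
qed

section \<open>Completeness of the list, and the dependent case\<close>

lemma kannappan_families:
  assumes \<sigma>: "involutive_automorphism \<sigma>" and eq: "kannappan_sine_subtraction \<sigma> z f g"
    and fg: "lin_indep f g"
  shows "(\<exists>\<gamma> b c \<mu>. family3 \<sigma> z f g \<gamma> b c \<mu>) \<or> (\<exists>\<beta> b c \<mu>. family4 \<sigma> z f g \<beta> b c \<mu>)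
    \<or> (\<exists>\<alpha> \<delta> b c \<mu>. family5 \<sigma> z f g \<alpha> \<delta> b c \<mu>)
    \<or> (\<exists>\<gamma> c \<mu> A \<rho>. family6 \<sigma> z f g \<gamma> c \<mu> A \<rho>)
    \<or> (\<exists>\<alpha> c \<delta> \<mu> A \<rho>. family7 \<sigma> z f g \<alpha> c \<delta> \<mu> A \<rho>)"
proof -
  obtain k h s f1 f2 g1 g2 where hk: "lin_indep h k"
    and f: "\<And>x. f x = f1 * h x + f2 * k x" and g: "\<And>x. g x = g1 * h x + g2 * k x"
    and odd: "\<And>x. k (\<sigma> x) = - k x" and even: "\<And>x. h (\<sigma> x) = h x"
    and k: "\<And>x y. k (x * y) = k x * h y + k y * h x"
    and h: "\<And>x y. h (x * y) = h x * h y + s * k x * k y"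
    by (rule kannappan_sine_reduction[OF \<sigma> eq fg]) (rule that)
  show ?thesis
  proof (cases "s = 0")
    case True
    have \<mu>: "exponential h"
      using h lin_indep_nonzero(1)[OF hk] True
      by (auto simp: exponential_def multiplicative_def)
    have det: "f2 * g1 - f1 * g2 \<noteq> 0"
      using lin_indep_det_coeffs[where p = h and q = k, OF fg f g] by (auto simp: algebra_simps)
    note z = sine_pair_constraints[where \<mu> = h and k = k, OF eq \<mu> hk even odd k f g]
    show ?thesis
      using sine_pair_families[OF \<mu> lin_indep_nonzero(2)[OF hk] even odd k f g z det] by blast
  next
    case False
    define t where "t = csqrt s"
    have t: "t \<noteq> 0" and s: "s = t * t" 
      using False by (simp_all add: t_def flip: power2_eq_square)
    define \<mu> where "\<mu> x = h x + t * k x" for x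
    have \<mu>\<sigma>: "\<mu> (\<sigma> x) = h x - t * k x" for x by (simp add: \<mu>_def even odd)
    have "lin_indep (\<lambda>x. 1 * h x + t * k x) (\<lambda>x. 1 * h x + (- t) * k x)"
      by (rule lin_indep_transform[OF hk]) (use t in simp)
    moreover have "\<mu> = (\<lambda>x. 1 * h x + t * k x)" "\<mu> \<circ> \<sigma> = (\<lambda>x. 1 * h x + (- t) * k x)"
      by (simp_all add: fun_eq_iff \<mu>\<sigma>) (simp add: \<mu>_def)
    ultimately have ind: "lin_indep \<mu> (\<mu> \<circ> \<sigma>)" by simp
    have "\<mu> (x * y) = \<mu> x * \<mu> y" for x y
      by (simp add: \<mu>_def h k s algebra_simps)
    then have \<mu>: "exponential \<mu>"
      using lin_indep_nonzero(1)[OF ind] by (auto simp: exponential_def multiplicative_def)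
    obtain x where "k x \<noteq> 0" using lin_indep_nonzero(2)[OF hk] by blast
    then have "\<mu> x \<noteq> (\<mu> \<circ> \<sigma>) x" using t by (simp add: \<mu>\<sigma>) (simp add: \<mu>_def eq_neg_iff_add_eq_0)
    then have ne: "\<mu> \<noteq> \<mu> \<circ> \<sigma>" by metis
    \<comment> \<open>\<open>h\<close> and \<open>t * k\<close> are the even and odd parts of
      \<open>\<mu>\<close>, which turns \<open>f\<close> and \<open>g\<close> into combinations of
      \<open>\<mu>\<close> and \<open>\<mu> \<circ> \<sigma>\<close>.\<close>
    have hk_eq: "h x = (\<mu> x + \<mu> (\<sigma> x)) / 2" "k x = (\<mu> x - \<mu> (\<sigma> x)) / (2 * t)" for x
      unfolding \<mu>\<sigma> using t by (simp_all add: \<mu>_def)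
    have f': "f x = (f1 / 2 + f2 / (2 * t)) * \<mu> x + (f1 / 2 - f2 / (2 * t)) * \<mu> (\<sigma> x)"
      and g': "g x = (g1 / 2 + g2 / (2 * t)) * \<mu> x + (g1 / 2 - g2 / (2 * t)) * \<mu> (\<sigma> x)" for x
      unfolding f g hk_eq using t by (simp_all add: divide_simps) (simp_all add: algebra_simps)
    note z = exponential_pair_constraints[where \<mu> = \<mu>, OF \<sigma> eq \<mu> ind f' g']
    note det = lin_indep_det_coeffs[where p = \<mu> and q = "\<lambda>x. \<mu> (\<sigma> x)", OF fg f' g']
    show ?thesis
      using exponential_pair_families[OF \<mu> ne f' g' z det] by blast
  qed
qed

text \<open>Proportional functions have zero determinant, and \<open>\<sigma>\<close> is surjective,
  so the equation says that \<open>f\<close> vanishes on \<open>S2z z\<close>. As \<open>f\<close>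
  is nonzero, that set is then proper.\<close>

lemma kannappan_dependent:
  assumes \<sigma>: "involutive_automorphism \<sigma>" and f: "f \<noteq> (\<lambda>x. 0)" and g: "g = (\<lambda>x. \<kappa> * f x)"
  shows "kannappan_sine_subtraction \<sigma> z f g \<longleftrightarrow> UNIV \<noteq> S2z z \<and> (\<forall>x \<in> S2z z. f x = 0)"
proof -
  have "kannappan_sine_subtraction \<sigma> z f g \<longleftrightarrow> (\<forall>x y. f (x * \<sigma> y * z) = 0)"
    unfolding kannappan_sine_subtraction_def g by (simp add: algebra_simps)
  also have "\<dots> \<longleftrightarrow> (\<forall>x \<in> S2z z. f x = 0)"
    unfolding S2z_def by (auto, metis involutive_automorphismD(2)[OF \<sigma>])
  finally show ?thesis using f by auto
qed

section \<open>Continuity of the parameters\<close>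

lemma continuous_fun_lincomb:
  assumes "continuous_fun X f" "continuous_fun X g" and "\<And>x. h x = a * f x + b * g x"
  shows "continuous_fun X h"
proof -
  have "continuous_fun X (\<lambda>x. a * f x + b * g x)"
    using assms(1,2) by (simp add: continuous_map_atin tendsto_add tendsto_mult)
  then show ?thesis by (simp add: assms(3)[abs_def])
qed

text \<open>Cramer's rule expresses \<open>\<mu>\<close> and \<open>\<mu> \<circ> \<sigma>\<close>
  as linear combinations of the continuous functions \<open>f\<close> and \<open>g\<close>.\<close>

lemma continuous_exponential_pair:
  assumes "continuous_fun X f" "continuous_fun X g"
    and f: "\<And>x. f x = a * (\<mu> x + (\<mu> \<circ> \<sigma>) x) + b * (\<mu> x - (\<mu> \<circ> \<sigma>) x)"
    and g: "\<And>x. g x = c * (\<mu> x + (\<mu> \<circ> \<sigma>) x) + d * (\<mu> x - (\<mu> \<circ> \<sigma>) x)"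
    and det: "a * d - b * c \<noteq> 0"
  shows "continuous_fun X \<mu>" "continuous_fun X (\<mu> \<circ> \<sigma>)"
proof -
  let ?D = "2 * (a * d - b * c)"
  have "?D * \<mu> x = (d - c) * f x + (a - b) * g x"
    "?D * (\<mu> \<circ> \<sigma>) x = (d + c) * f x + - (a + b) * g x" for x
    unfolding f g by (simp_all add: algebra_simps)
  then have "\<mu> x = (d - c) / ?D * f x + (a - b) / ?D * g x"
    "(\<mu> \<circ> \<sigma>) x = (d + c) / ?D * f x + - (a + b) / ?D * g x" for x
    using det by (simp_all add: divide_simps) (simp_all add: mult_ac)
  from this[THEN continuous_fun_lincomb[OF assms(1,2)]]
  show "continuous_fun X \<mu>" "continuous_fun X (\<mu> \<circ> \<sigma>)" .
qed

text \<open>\<open>\<mu>\<close> and \<open>Psi\<close> are linear combinations of \<open>f\<close>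
  and \<open>g\<close>. Then \<open>A\<close> is the quotient of \<open>Psi\<close> by
  \<open>\<mu>\<close> off the null space, and \<open>\<rho>\<close> is the restriction of
  \<open>Psi\<close> to \<open>P_set\<close>.\<close>

lemma continuous_sine_pair:
  assumes fg: "continuous_fun X f" "continuous_fun X g"
    and f: "\<And>x. f x = a * \<mu> x + b * Psi \<mu> A \<rho> x" and g: "\<And>x. g x = c * \<mu> x + d * Psi \<mu> A \<rho> x"
    and det: "a * d - b * c \<noteq> 0" and sym: "\<mu> \<circ> \<sigma> = \<mu>"
  shows "continuous_fun X \<mu> \<and> continuous_fun X (\<mu> \<circ> \<sigma>) \<and>
    continuous_fun (subtopology X (- null_space \<mu>)) A \<and>
    continuous_fun (subtopology X (P_set \<mu>)) \<rho>"
proof -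
  let ?D = "a * d - b * c"
  have "?D * \<mu> x = d * f x + - b * g x" "?D * Psi \<mu> A \<rho> x = - c * f x + a * g x" for x
    unfolding f g by (simp_all add: algebra_simps)
  then have "\<mu> x = d / ?D * f x + - b / ?D * g x" "Psi \<mu> A \<rho> x = - c / ?D * f x + a / ?D * g x" for x
    using det by (simp_all add: divide_simps) (simp_all add: mult_ac)
  from this[THEN continuous_fun_lincomb[OF fg]]
  have \<mu>: "continuous_fun X \<mu>" and \<Psi>: "continuous_fun X (Psi \<mu> A \<rho>)" .
  have "continuous_fun (subtopology X (- null_space \<mu>)) (\<lambda>x. Psi \<mu> A \<rho> x / \<mu> x)"
    using continuous_map_from_subtopology[OF \<mu>] continuous_map_from_subtopology[OF \<Psi>]
    by (simp add: continuous_map_atin tendsto_divide null_space_def)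
  then have A: "continuous_fun (subtopology X (- null_space \<mu>)) A"
    by (rule continuous_map_eq) (simp add: Psi_def null_space_def)
  have "continuous_fun (subtopology X (P_set \<mu>)) \<rho>"
    by (rule continuous_map_eq[OF continuous_map_from_subtopology[OF \<Psi>]])
      (simp add: Psi_def P_set_iff)
  with \<mu> A sym show ?thesis by simp
qed

lemma family3_continuous:
  assumes "continuous_fun X f" "continuous_fun X g" and "family3 \<sigma> z f g \<gamma> b c \<mu>"
  shows "continuous_fun X \<mu> \<and> continuous_fun X (\<mu> \<circ> \<sigma>)"
proof -
  note F = assms(3)[unfolded family3_def]
  have "f x = 1 / (2 * \<gamma>) * (\<mu> x + (\<mu> \<circ> \<sigma>) x) + c / (2 * \<gamma>) * (\<mu> x - (\<mu> \<circ> \<sigma>) x)"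
    "g x = 0 * (\<mu> x + (\<mu> \<circ> \<sigma>) x) + b * (\<mu> x - (\<mu> \<circ> \<sigma>) x)" for x
    using F by simp_all
  from continuous_exponential_pair[OF assms(1,2) this] show ?thesis using F by simp
qed

lemma family4_continuous:
  assumes "continuous_fun X f" "continuous_fun X g" and "family4 \<sigma> z f g \<beta> b c \<mu>"
  shows "continuous_fun X \<mu> \<and> continuous_fun X (\<mu> \<circ> \<sigma>)"
proof -
  note F = assms(3)[unfolded family4_def]
  have "f x = 0 * (\<mu> x + (\<mu> \<circ> \<sigma>) x) + b * (\<mu> x - (\<mu> \<circ> \<sigma>) x)"
    "g x = 1 / (2 * \<beta>) * (\<mu> x + (\<mu> \<circ> \<sigma>) x) + c / (2 * \<beta>) * (\<mu> x - (\<mu> \<circ> \<sigma>) x)" for x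
    using F by simp_all
  from continuous_exponential_pair[OF assms(1,2) this] show ?thesis using F by simp
qed

lemma family5_continuous:
  assumes "continuous_fun X f" "continuous_fun X g" and "family5 \<sigma> z f g \<alpha> \<delta> b c \<mu>"
  shows "continuous_fun X \<mu> \<and> continuous_fun X (\<mu> \<circ> \<sigma>)"
proof -
  note F = assms(3)[unfolded family5_def]
  let ?b = "(\<alpha> * c + 2 * b * \<delta>) / (2 * \<delta>)"
  have fg: "f x = \<alpha> / (2 * \<delta>) * (\<mu> x + (\<mu> \<circ> \<sigma>) x) + ?b * (\<mu> x - (\<mu> \<circ> \<sigma>) x)"
    "g x = 1 / (2 * \<delta>) * (\<mu> x + (\<mu> \<circ> \<sigma>) x) + c / (2 * \<delta>) * (\<mu> x - (\<mu> \<circ> \<sigma>) x)" for x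
    using F by simp_all
  have "\<delta> \<noteq> 0" "b \<noteq> 0" using F by blast+
  \<comment> \<open>The terms in \<open>\<alpha> * c\<close> cancel and leave
    \<open>- b / (2 * \<delta>)\<close>.\<close>
  then have "\<alpha> / (2 * \<delta>) * (c / (2 * \<delta>)) - ?b * (1 / (2 * \<delta>)) \<noteq> 0"
    by (simp add: divide_simps)
  from continuous_exponential_pair[OF assms(1,2) fg this] show ?thesis by simp
qed

lemma family6_continuous:
  assumes "continuous_fun X f" "continuous_fun X g" and "family6 \<sigma> z f g \<gamma> c \<mu> A \<rho>"
  shows "continuous_fun X \<mu> \<and> continuous_fun X (\<mu> \<circ> \<sigma>) \<and>
    continuous_fun (subtopology X (- null_space \<mu>)) A \<and>
    continuous_fun (subtopology X (P_set \<mu>)) \<rho>"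
proof -
  note F = assms(3)[unfolded family6_def]
  have fg: "f x = \<gamma> * \<mu> x + \<gamma> * c * Psi \<mu> A \<rho> x" "g x = 0 * \<mu> x + 1 * Psi \<mu> A \<rho> x" for x
    using F by (simp_all add: distrib_left mult.assoc)
  show ?thesis by (rule continuous_sine_pair[OF assms(1,2) fg]) (use F in simp_all)
qed

lemma family7_continuous:
  assumes "continuous_fun X f" "continuous_fun X g" and "family7 \<sigma> z f g \<alpha> c \<delta> \<mu> A \<rho>"
  shows "continuous_fun X \<mu> \<and> continuous_fun X (\<mu> \<circ> \<sigma>) \<and>
    continuous_fun (subtopology X (- null_space \<mu>)) A \<and>
    continuous_fun (subtopology X (P_set \<mu>)) \<rho>"
proof -
  note F = assms(3)[unfolded family7_def]
  define s where "s = \<alpha> * c + \<delta>"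
  have fg: "f x = \<alpha> / \<delta> * \<mu> x + s / \<delta> * Psi \<mu> A \<rho> x" "g x = 1 / \<delta> * \<mu> x + c / \<delta> * Psi \<mu> A \<rho> x" for x
    using F by (simp_all add: s_def[symmetric] add_divide_distrib)
  have "\<delta> \<noteq> 0" "\<mu> \<circ> \<sigma> = \<mu>" using F by blast+
  \<comment> \<open>The left-hand side is \<open>- 1 / \<delta>\<close>, since
    \<open>s - \<alpha> * c = \<delta>\<close>.\<close>
  moreover from this(1) have "\<alpha> / \<delta> * (c / \<delta>) - s / \<delta> * (1 / \<delta>) \<noteq> 0"
    by (simp add: divide_simps) (simp add: s_def)
  ultimately show ?thesis by (intro continuous_sine_pair[OF assms(1,2) fg])
qed

theorem theorem5p1:
  fixes \<sigma> :: "'a::semigroup_mult \<Rightarrow> 'a" and z\<^sub>0 :: 'a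
    and f g :: "'a \<Rightarrow> complex"
  assumes "involutive_automorphism \<sigma>"
  shows "(kannappan_sine_subtraction \<sigma> z\<^sub>0 f g \<longleftrightarrow>
      f = (\<lambda>x. 0)
    \<or> (UNIV \<noteq> S2z z\<^sub>0 \<and> f \<noteq> (\<lambda>x. 0) \<and> (\<forall>x \<in> S2z z\<^sub>0. f x = 0) \<and> (\<exists>\<kappa>. g = (\<lambda>x. \<kappa> * f x)))
    \<or> (\<exists>\<gamma> b c \<mu>. family3 \<sigma> z\<^sub>0 f g \<gamma> b c \<mu>)
    \<or> (\<exists>\<beta> b c \<mu>. family4 \<sigma> z\<^sub>0 f g \<beta> b c \<mu>)
    \<or> (\<exists>\<alpha> \<delta> b c \<mu>. family5 \<sigma> z\<^sub>0 f g \<alpha> \<delta> b c \<mu>)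
    \<or> (\<exists>\<gamma> c \<mu> A \<rho>. family6 \<sigma> z\<^sub>0 f g \<gamma> c \<mu> A \<rho>)
    \<or> (\<exists>\<alpha> c \<delta> \<mu> A \<rho>. family7 \<sigma> z\<^sub>0 f g \<alpha> c \<delta> \<mu> A \<rho>))
    \<and>
    (\<forall>X. topological_semigroup X \<and> continuous_fun X f \<and> continuous_fun X g \<longrightarrow>
      (\<forall>\<gamma> b c \<mu>. family3 \<sigma> z\<^sub>0 f g \<gamma> b c \<mu> \<longrightarrow>
         continuous_fun X \<mu> \<and> continuous_fun X (\<mu> \<circ> \<sigma>))
    \<and> (\<forall>\<beta> b c \<mu>. family4 \<sigma> z\<^sub>0 f g \<beta> b c \<mu> \<longrightarrow>
         continuous_fun X \<mu> \<and> continuous_fun X (\<mu> \<circ> \<sigma>))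
    \<and> (\<forall>\<alpha> \<delta> b c \<mu>. family5 \<sigma> z\<^sub>0 f g \<alpha> \<delta> b c \<mu> \<longrightarrow>
         continuous_fun X \<mu> \<and> continuous_fun X (\<mu> \<circ> \<sigma>))
    \<and> (\<forall>\<gamma> c \<mu> A \<rho>. family6 \<sigma> z\<^sub>0 f g \<gamma> c \<mu> A \<rho> \<longrightarrow>
         continuous_fun X \<mu> \<and> continuous_fun X (\<mu> \<circ> \<sigma>) \<and>
         continuous_fun (subtopology X (- null_space \<mu>)) A \<and>
         continuous_fun (subtopology X (P_set \<mu>)) \<rho>)
    \<and> (\<forall>\<alpha> c \<delta> \<mu> A \<rho>. family7 \<sigma> z\<^sub>0 f g \<alpha> c \<delta> \<mu> A \<rho> \<longrightarrow>
         continuous_fun X \<mu> \<and> continuous_fun X (\<mu> \<circ> \<sigma>) \<and>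
         continuous_fun (subtopology X (- null_space \<mu>)) A \<and>
         continuous_fun (subtopology X (P_set \<mu>)) \<rho>))"
proof (rule conjI, goal_cases)
  case 1
  note \<sigma> = assms
  show ?case (is "?eq \<longleftrightarrow> ?zero \<or> ?dep \<or> ?families")
  proof
    assume eq: ?eq
    show "?zero \<or> ?dep \<or> ?families"
    proof (cases "f = (\<lambda>x. 0)")
      case True
      then show ?thesis by (rule disjI1)
    next
      case f: False
      show ?thesis
      \<comment> \<open>Independent solutions fall into families 3 to 7. In the dependent case
        \<open>g\<close> is a multiple of the nonzero \<open>f\<close>, which gives solution
        (2).\<close>
      proof (cases "lin_indep f g")
        case True
        show ?thesis by (intro disjI2 kannappan_families[OF \<sigma> eq True])
      next
        case False
        obtain \<kappa> where g: "g = (\<lambda>x. \<kappa> * f x)" using lin_dep_multiple[OF False f] by blast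
        have "UNIV \<noteq> S2z z\<^sub>0 \<and> (\<forall>x \<in> S2z z\<^sub>0. f x = 0)"
          using kannappan_dependent[OF \<sigma> f g] eq by simp
        with f g have ?dep by (intro conjI exI[of _ \<kappa>]) simp_all
        then show ?thesis by (rule disjI2[OF disjI1])
      qed
    qed
  next
    have zero: ?eq if ?zero using that by (simp add: kannappan_sine_subtraction_def)
    have dep: ?eq if ?dep
    proof -
      from that obtain \<kappa> where g: "g = (\<lambda>x. \<kappa> * f x)" by (elim conjE exE)
      from that have "f \<noteq> (\<lambda>x. 0)" "UNIV \<noteq> S2z z\<^sub>0 \<and> (\<forall>x \<in> S2z z\<^sub>0. f x = 0)" by simp_all
      then show ?thesis using kannappan_dependent[OF \<sigma> _ g] by simp
    qed
    have families: ?eq if ?families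
      using that
      by (elim disjE exE) (erule family3_kannappan[OF \<sigma>] family4_kannappan[OF \<sigma>]
          family5_kannappan[OF \<sigma>] family6_kannappan[OF \<sigma>] family7_kannappan[OF \<sigma>])+
    assume "?zero \<or> ?dep \<or> ?families"
    then show ?eq by (rule disjE[OF _ zero disjE[OF _ dep families]])
  qed
next
  case 2
  show ?case
  proof (intro allI impI, elim conjE, goal_cases)
    case (1 X)
    note fg = 1(2,3)
    show ?case
      by (intro conjI[OF _ conjI[OF _ conjI[OF _ conjI]]] allI impI)
        (erule family3_continuous[OF fg] family4_continuous[OF fg] family5_continuous[OF fg]
          family6_continuous[OF fg] family7_continuous[OF fg])+
  qed
qed

end
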